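(* Let $n\ge 1$, let $J$ be a real symmetric $n\times n$ matrix with $0\preceq J\prec \mathrm{Id}$, let $h\in\mathbb{R}^n$, and let $\nu_0$ be the probability measure on $\{\pm1\}^n$ given by $$d\nu_0(x)=\frac1Z\exp\left(\tfrac12\langle x,Jx\rangle+\langle h,x\rangle\right)d\mu(x),$$ where $\mu$ is the uniform probability measure on $\{\pm1\}^n$ and $Z$ is the normalizing constant. Let $P_t$ denote the transition kernel of the continuous-time Glauber dynamics for $\nu_0$. Then for every $\epsilon>0$, $$\max_{x\in\{\pm1\}^n}\|P_t(x,\cdot)-\nu_0\|_{TV}\le\epsilon$$ as long as $t\ge 0$ satisfies $$t\ge\frac{1}{1-\|J\|_{OP}}\left((1+2\|J\|_{OP})\,n+2|h|_1+\log\frac1\epsilon\right).$$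
   Context: $\preceq$ and $\prec$ denote the Loewner order on symmetric matrices, $\|J\|_{OP}$ is the $\ell_2\to\ell_2$ operator norm, $|h|_1=\sum_i|h_i|$, and $\|\mathbb{P}-\mathbb{Q}\|_{TV}=\sup_A|\mathbb{P}(A)-\mathbb{Q}(A)|$. The continuous-time Glauber dynamics for a probability measure $\nu$ on $\{\pm1\}^n$ is the Markov semigroup $P_t=e^{t\mathcal{L}_\nu}$ with generator $$(\mathcal{L}_\nu\varphi)(x)=\sum_{i=1}^n\big(\mathbb{E}_\nu[\varphi(X)\mid X_{\sim i}=x_{\sim i}]-\varphi(x)\big),$$ where $x_{\sim i}=(x_j)_{j\neq i}$; $P_t(x,\cdot)$ is the law at time $t$ of the chain started at $x$. *)

theory Defs
  imports "HOL-Probability.Probability"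
begin

text \<open>The Loewner order; only meant for symmetric matrices.\<close>

definition loewner_le :: "real^'n^'n \<Rightarrow> real^'n^'n \<Rightarrow> bool" where
  "loewner_le A B \<longleftrightarrow> (\<forall>v. 0 \<le> v \<bullet> ((B - A) *v v))"

definition loewner_less :: "real^'n^'n \<Rightarrow> real^'n^'n \<Rightarrow> bool" where
  "loewner_less A B \<longleftrightarrow> (\<forall>v. v \<noteq> 0 \<longrightarrow> 0 < v \<bullet> ((B - A) *v v))"

definition cube :: "(real^'n) set" where
  "cube = {x. \<forall>i. x $ i \<in> {-1, 1}}"

definition ising_weight :: "real^'n^'n \<Rightarrow> real^'n \<Rightarrow> real^'n \<Rightarrow> real" where
  "ising_weight J h x = exp (1/2 * (x \<bullet> (J *v x)) + h \<bullet> x)"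

definition ising_partition :: "real^'n^'n \<Rightarrow> real^'n \<Rightarrow> real" where
  "ising_partition J h = (\<integral>x. ising_weight J h x \<partial>uniform_count_measure cube)"

definition ising_measure :: "real^'n^'n \<Rightarrow> real^'n \<Rightarrow> (real^'n) measure" where
  "ising_measure J h =
     density (uniform_count_measure cube) (\<lambda>x. ennreal (ising_weight J h x / ising_partition J h))"

text \<open>The conditional expectation given \<open>X\<^sub>j = x\<^sub>j\<close> for all \<open>j \<noteq> i\<close> is the integral against the
  normalised restriction (\<^const>\<open>uniform_measure\<close>) of \<open>\<nu>\<close> to that event. This is elementary
  conditioning, hence meaningful at every \<open>x\<close> for which the event has positive probability.\<close>

definition glauber_generator ::
    "(real^'n) measure \<Rightarrow> (real^'n \<Rightarrow> real) \<Rightarrow> real^'n \<Rightarrow> real" where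
  "glauber_generator \<nu> \<phi> x =
     (\<Sum>i\<in>UNIV. (\<integral>y. \<phi> y \<partial>uniform_measure \<nu> {y \<in> space \<nu>. \<forall>j. j \<noteq> i \<longrightarrow> y $ j = x $ j}) - \<phi> x)"

text \<open>The operator exponential \<open>exp (t \<L>)\<close> as a pointwise power series. For measures on the finite
  set \<^const>\<open>cube\<close> with full support it converges at every point of the cube.\<close>

definition glauber_semigroup ::
    "(real^'n) measure \<Rightarrow> real \<Rightarrow> (real^'n \<Rightarrow> real) \<Rightarrow> real^'n \<Rightarrow> real" where
  "glauber_semigroup \<nu> t \<phi> x = (\<Sum>k. t ^ k / fact k * (glauber_generator \<nu> ^^ k) \<phi> x)"

text \<open>The measure \<open>P\<^sub>t(x, \<cdot>)\<close>, whose mass at \<open>y\<close> is \<open>(P\<^sub>t 1\<^bsub>{y}\<^esub>)(x)\<close>.\<close>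

definition glauber_kernel ::
    "(real^'n) measure \<Rightarrow> real \<Rightarrow> real^'n \<Rightarrow> (real^'n) measure" where
  "glauber_kernel \<nu> t x =
     point_measure cube (\<lambda>y. ennreal (glauber_semigroup \<nu> t (indicator {y}) x))"

text \<open>For probability measures on the same measurable space.\<close>

definition tv_dist :: "'a measure \<Rightarrow> 'a measure \<Rightarrow> real" where
  "tv_dist M N = (SUP A\<in>sets M. \<bar>measure M A - measure N A\<bar>)"

end

theory Submission imports Defs "HOL-Real_Asymp.Real_Asymp" begin

text \<open>Everything follows from the Poincare inequality with constant \<open>1 - \<parallel>J\<parallel>\<close> for the heat-bath
  Dirichlet form: it makes the variance of \<open>P\<^sub>t 1\<^bsub>{y}\<^esub>\<close> decay like \<open>exp (- 2 (1 - \<parallel>J\<parallel>) t)\<close>, and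
  the Cauchy-Schwarz inequality over \<open>y\<close> together with a crude lower bound on the point masses
  converts this into total variation.

  The Poincare inequality is proved by peeling rank-one terms off \<open>J\<close>. If \<open>J = J' + u u\<^sup>T\<close>, then
  observing \<open>g = u \<bullet> x + N(0,1)\<close> decomposes the Ising measure into Ising measures with interaction
  \<open>J'\<close> and field \<open>h + g u\<close>. The Dirichlet form is a supermartingale under this decomposition. For the
  variance, a one-dimensional Brascamp-Lieb type argument gives
  \<open>Var F \<le> E (sup\<^sub>s (Var\<^sub>g (F + s (u \<bullet> x)) - s\<^sup>2))\<close>; the linear tilts are carried along until \<open>J\<close> is
  exhausted, where the Efron-Stein inequality for product measures applies.\<close>

section \<open>Variance under Gaussian observation\<close>

text \<open>Only a primitive with finite limits at both ends is required, so the total mass stays an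
  unspecified \<open>c\<close> and the Gaussian integral need not be evaluated.\<close>

lemma gaussian_antiderivative:
  obtains \<Phi> :: "real \<Rightarrow> real" and c where "0 < c"
    and "\<And>x. (\<Phi> has_real_derivative exp (- x\<^sup>2 / 2)) (at x)"
    and "(\<Phi> \<longlongrightarrow> 0) at_bot" and "(\<Phi> \<longlongrightarrow> c) at_top"
proof -
  define E :: "real \<Rightarrow> real" where "E = (\<lambda>x. LBINT y=0..x. exp (- y\<^sup>2 / 2))"
  have dE: "(E has_real_derivative exp (- x\<^sup>2 / 2)) (at x)" for x
  proof -
    have "(E has_vector_derivative exp (- x\<^sup>2 / 2)) (at x within {- \<bar>x\<bar> - 1..\<bar>x\<bar> + 1})"
      unfolding E_def zero_ereal_def
      by (rule interval_integral_FTC2) (auto intro!: continuous_intros)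
    moreover have "at x within {- \<bar>x\<bar> - 1..\<bar>x\<bar> + 1} = at x"
      by (rule at_within_Icc_at) auto
    ultimately show ?thesis by (simp add: has_real_derivative_iff_has_vector_derivative)
  qed
  have E0: "E 0 = 0" by (simp add: E_def zero_ereal_def)
  have mono: "E x \<le> E y" if "x \<le> y" for x y
    by (rule DERIV_nonneg_imp_nondecreasing[OF that]) (use dE in \<open>force\<close>)
  \<comment> \<open>Oddness transfers the limit at \<open>at_top\<close> to \<open>at_bot\<close>;
    the final shift by \<open>c\<close> moves the lower limit to 0.\<close>
  have odd: "E (- x) = - E x" for x
  proof -
    have "((\<lambda>x. E (- x) + E x) has_real_derivative 0) (at x)" for x
      by (rule derivative_eq_intros DERIV_chain2[OF dE] dE refl | simp)+
    then have "E (-x) + E x = E (-0) + E 0"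
      using DERIV_isconst_all[of "\<lambda>x. E (- x) + E x"] by blast
    then show ?thesis using E0 by simp
  qed
  \<comment> \<open>Comparison with \<open>2 * arctan\<close>, whose derivative dominates the
    Gaussian because \<open>exp (y\<^sup>2 / 2)\<close> is at least
    \<open>(1 + y\<^sup>2) / 2\<close>.\<close>
  have bound: "E x \<le> pi" for x
  proof (cases "0 \<le> x")
    case True
    have "2 * arctan 0 - E 0 \<le> 2 * arctan x - E x"
    proof (rule DERIV_nonneg_imp_nondecreasing[OF True])
      fix y :: real
      have pos: "0 < 1 + y\<^sup>2" by (simp add: add_pos_nonneg)
      have "(1 + y\<^sup>2) / 2 = 1 / 2 + y\<^sup>2 / 2" by (simp add: add_divide_distrib)
      also have "\<dots> \<le> 1 + y\<^sup>2 / 2" by simp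
      also have "\<dots> \<le> exp (y\<^sup>2 / 2)" by (rule exp_ge_add_one_self)
      finally have "(1 + y\<^sup>2) / 2 \<le> exp (y\<^sup>2 / 2)" .
      from le_imp_inverse_le[OF this] pos
      have "0 \<le> 2 * inverse (1 + y\<^sup>2) - exp (- y\<^sup>2 / 2)" by (simp add: exp_minus inverse_eq_divide)
      moreover have "((\<lambda>x. 2 * arctan x - E x) has_real_derivative 2 * inverse (1 + y\<^sup>2) - exp (- y\<^sup>2 / 2)) (at y)"
        by (rule derivative_eq_intros dE refl | simp)+
      ultimately show "\<exists>z. ((\<lambda>x. 2 * arctan x - E x) has_real_derivative z) (at y) \<and> 0 \<le> z"
        by blast
    qed
    then show ?thesis using arctan_ubound[of x] E0 by simp
  next
    case False
    then show ?thesis using mono[of x 0] E0 pi_gt_zero by linarith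
  qed
  define c where "c = (SUP x. E x)"
  have bdd: "bdd_above (range E)" using bound by (auto intro!: bdd_aboveI)
  have le_c: "E x \<le> c" for x
    unfolding c_def by (rule cSUP_upper[OF _ bdd]) simp
  have top: "(E \<longlongrightarrow> c) at_top"
  proof (rule increasing_tendsto)
    show "\<forall>\<^sub>F x in at_top. E x \<le> c" using le_c by simp
    fix z assume "z < c"
    then obtain y where y: "z < E y" unfolding c_def using less_cSUP_iff[OF _ bdd] by auto
    show "\<forall>\<^sub>F x in at_top. z < E x"
      using eventually_ge_at_top[of y] by eventually_elim (use mono y less_le_trans in blast)
  qed
  have "((\<lambda>x. E (- x)) \<longlongrightarrow> - c) at_top" unfolding odd by (intro tendsto_intros top)
  then have bot: "(E \<longlongrightarrow> - c) at_bot" by (simp add: filterlim_at_bot_mirror)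
  have "E 0 < E 1"
    by (rule DERIV_pos_imp_increasing) (use dE in force)+
  then have "0 < c" using E0 le_c[of 1] by linarith
  show ?thesis
  proof (rule that[of "2 * c" "\<lambda>x. E x + c"])
    show "((\<lambda>x. E x + c) \<longlongrightarrow> 0) at_bot" using tendsto_add[OF bot tendsto_const[of c]] by simp
    show "((\<lambda>x. E x + c) \<longlongrightarrow> 2 * c) at_top" using tendsto_add[OF top tendsto_const[of c]] by simp
    show "((\<lambda>x. E x + c) has_real_derivative exp (- x\<^sup>2 / 2)) (at x)" for x
      by (rule derivative_eq_intros dE refl | simp)+
  qed (use \<open>0 < c\<close> in simp)
qed

lemma tendsto_gaussian:
  "((\<lambda>x::real. exp (- x\<^sup>2 / 2)) \<longlongrightarrow> 0) at_top" "((\<lambda>x::real. exp (- x\<^sup>2 / 2)) \<longlongrightarrow> 0) at_bot"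
  "((\<lambda>x::real. x * exp (- x\<^sup>2 / 2)) \<longlongrightarrow> 0) at_top" "((\<lambda>x::real. x * exp (- x\<^sup>2 / 2)) \<longlongrightarrow> 0) at_bot"
  by real_asymp+

lemma filterlim_diff_const:
  "filterlim (\<lambda>g::real. g - a) at_top at_top" "filterlim (\<lambda>g::real. g - a) at_bot at_bot"
  by real_asymp+

text \<open>For \<open>y \<le> -1\<close> the derivative of the Gaussian, \<open>- y\<close> times
  itself, is at least that of \<open>\<Phi>\<close>, and both functions vanish at
  \<open>- \<infinity>\<close>. The tail bounds later keep the multiplier \<open>s\<close>
  bounded.\<close>

lemma gaussian_tail_bot:
  fixes \<Phi> :: "real \<Rightarrow> real"
  assumes d: "\<And>x. (\<Phi> has_real_derivative exp (- x\<^sup>2 / 2)) (at x)"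
    and bot: "(\<Phi> \<longlongrightarrow> 0) at_bot" and "y \<le> -1"
  shows "\<bar>\<Phi> y\<bar> \<le> exp (- y\<^sup>2 / 2)"
proof -
  let ?G = "\<lambda>x::real. exp (- x\<^sup>2 / 2)"
  have "?G x - \<Phi> x \<le> ?G y - \<Phi> y" if "x \<le> y" for x
  proof (rule DERIV_nonneg_imp_nondecreasing[OF that])
    fix z assume "x \<le> z" "z \<le> y"
    then have "0 \<le> - z * ?G z - ?G z" using assms(3) mult_right_mono[of 1 "-z" "?G z"] by simp
    moreover have "((\<lambda>x. ?G x - \<Phi> x) has_real_derivative - z * ?G z - ?G z) (at z)"
      by (rule derivative_eq_intros d refl | simp)+
    ultimately show "\<exists>l. ((\<lambda>x. ?G x - \<Phi> x) has_real_derivative l) (at z) \<and> 0 \<le> l" by blast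
  qed
  moreover have "((\<lambda>x. ?G x - \<Phi> x) \<longlongrightarrow> 0 - 0) at_bot"
    by (intro tendsto_diff tendsto_gaussian bot)
  moreover from calculation(1) have "\<forall>\<^sub>F x in at_bot. ?G x - \<Phi> x \<le> ?G y - \<Phi> y"
    using eventually_le_at_bot[of y] by (rule eventually_mono[rotated])
  ultimately have 1: "0 \<le> ?G y - \<Phi> y"
    using tendsto_upperbound[of "\<lambda>x. ?G x - \<Phi> x" "0 - 0" at_bot "?G y - \<Phi> y"] by simp
  have "\<Phi> x \<le> \<Phi> y" if "x \<le> y" for x
    by (rule DERIV_nonneg_imp_nondecreasing[OF that]) (use d in force)
  then have "\<forall>\<^sub>F x in at_bot. \<Phi> x \<le> \<Phi> y"
    using eventually_le_at_bot[of y] by (rule eventually_mono[rotated])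
  then have "0 \<le> \<Phi> y" using tendsto_upperbound[OF bot, of "\<Phi> y"] by simp
  with 1 show ?thesis by simp
qed

text \<open>Reflection: the lower tail bound is applied to \<open>c - \<Phi> (- x)\<close>.\<close>

lemma gaussian_tail_top:
  fixes \<Phi> :: "real \<Rightarrow> real"
  assumes d: "\<And>x. (\<Phi> has_real_derivative exp (- x\<^sup>2 / 2)) (at x)"
    and top: "(\<Phi> \<longlongrightarrow> c) at_top" and "1 \<le> y"
  shows "\<bar>\<Phi> y - c\<bar> \<le> exp (- y\<^sup>2 / 2)"
proof -
  have "\<bar>(\<lambda>x. c - \<Phi> (- x)) (- y)\<bar> \<le> exp (- (- y)\<^sup>2 / 2)"
  proof (rule gaussian_tail_bot)
    show "((\<lambda>x. c - \<Phi> (- x)) has_real_derivative exp (- x\<^sup>2 / 2)) (at x)" for x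
      by (rule derivative_eq_intros DERIV_chain2[OF d] refl | simp)+
    have "((\<lambda>x. c - \<Phi> x) \<longlongrightarrow> c - c) at_top" by (intro tendsto_intros top)
    then show "((\<lambda>x. c - \<Phi> (- x)) \<longlongrightarrow> 0) at_bot" by (simp add: filterlim_at_bot_mirror)
  qed (use assms in simp)
  then show ?thesis by (simp add: abs_minus_commute)
qed

text \<open>With \<open>s = - N / R\<close>, where \<open>R\<close> is the density of the mixture and \<open>N\<close> the primitive of the
  \<open>f\<close>-weighted density, the hypothesis at \<open>g\<close> makes \<open>H\<close> below nondecreasing at \<open>g\<close>, and
  the claim compares its limits at \<open>- \<infinity>\<close> and \<open>\<infinity>\<close>. The function \<open>s\<close> solves the Poisson equation of the
  Langevin diffusion of the mixture, which is where Brascamp-Lieb enters.\<close>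

lemma gaussian_mixture_variance_centred:
  fixes p a f c :: "'a \<Rightarrow> real"
  assumes fin: "finite X" "X \<noteq> {}" and p: "\<And>x. x \<in> X \<Longrightarrow> 0 < p x"
    and centred: "(\<Sum>x\<in>X. p x * f x) = 0"
    and hyp: "\<And>g s. \<exists>b. (\<Sum>x\<in>X. p x * exp (- (g - a x)\<^sup>2 / 2) * (f x + s * a x - b)\<^sup>2)
      \<le> s\<^sup>2 * (\<Sum>x\<in>X. p x * exp (- (g - a x)\<^sup>2 / 2)) + (\<Sum>x\<in>X. c x * exp (- (g - a x)\<^sup>2 / 2))"
  shows "(\<Sum>x\<in>X. p x * (f x)\<^sup>2) \<le> (\<Sum>x\<in>X. c x)"
proof -
  obtain \<Phi> and \<kappa> :: real where \<kappa>: "0 < \<kappa>"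
    and d\<Phi>: "\<And>x. (\<Phi> has_real_derivative exp (- x\<^sup>2 / 2)) (at x)"
    and bot: "(\<Phi> \<longlongrightarrow> 0) at_bot" and top: "(\<Phi> \<longlongrightarrow> \<kappa>) at_top"
    using gaussian_antiderivative by metis
  define \<gamma> where "\<gamma> = (\<lambda>g x. exp (- (g - a x)\<^sup>2 / 2))"
  define R where "R = (\<lambda>g. \<Sum>x\<in>X. p x * \<gamma> g x)"
  define M where "M = (\<lambda>g. \<Sum>x\<in>X. p x * f x * \<gamma> g x)"
  \<comment> \<open>\<open>A1\<close> and \<open>B1\<close> are minus the derivatives of
    \<open>R\<close> and \<open>M\<close>, and \<open>A2 - R\<close> is the second derivative of
    \<open>R\<close>.\<close>
  define A1 where "A1 = (\<lambda>g. \<Sum>x\<in>X. p x * ((g - a x) * \<gamma> g x))"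
  define B1 where "B1 = (\<lambda>g. \<Sum>x\<in>X. p x * f x * ((g - a x) * \<gamma> g x))"
  define A2 where "A2 = (\<lambda>g. \<Sum>x\<in>X. p x * ((g - a x)\<^sup>2 * \<gamma> g x))"
  define F where "F = (\<lambda>g. \<Sum>x\<in>X. p x * (f x)\<^sup>2 * \<gamma> g x)"
  define C where "C = (\<lambda>g. \<Sum>x\<in>X. c x * \<gamma> g x)"
  define N where "N = (\<lambda>g. \<Sum>x\<in>X. p x * f x * \<Phi> (g - a x))"
  define s where "s = (\<lambda>g. - N g / R g)"
  define s' where "s' = (\<lambda>g. (s g * A1 g - M g) / R g)"
  \<comment> \<open>The first sum is a primitive of \<open>C - F\<close>; the subtracted terms
    vanish at both ends and complete the derivative to an expression that the hypothesis
    controls.\<close>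
  define H where "H = (\<lambda>g. (\<Sum>x\<in>X. (c x - p x * (f x)\<^sup>2) * \<Phi> (g - a x)) - (2 * s g * M g - (s g)\<^sup>2 * A1 g))"
  have \<gamma>_pos: "0 < \<gamma> g x" for g x by (simp add: \<gamma>_def)
  have R_pos: "0 < R g" for g
    unfolding R_def using fin p \<gamma>_pos by (intro sum_pos) (auto intro: mult_pos_pos)
  have d\<gamma>: "((\<lambda>g. \<gamma> g x) has_real_derivative - ((g - a x) * \<gamma> g x)) (at g)" for x g
    unfolding \<gamma>_def by (rule derivative_eq_intros refl | simp add: field_simps)+
  have d\<Phi>': "((\<lambda>g. \<Phi> (g - a x)) has_real_derivative \<gamma> g x) (at g)" for x g
  proof -
    have "((\<lambda>g. g - a x) has_real_derivative 1) (at g)"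
      by (rule derivative_eq_intros refl | simp)+
    from DERIV_chain2[OF d\<Phi> this] show ?thesis by (simp add: \<gamma>_def)
  qed
  have dR: "(R has_real_derivative - A1 g) (at g)" for g
    unfolding R_def A1_def sum_negf[symmetric]
    by (rule DERIV_sum) (rule derivative_eq_intros d\<gamma> refl | simp)+
  have dM: "(M has_real_derivative - B1 g) (at g)" for g
    unfolding M_def B1_def sum_negf[symmetric]
    by (rule DERIV_sum) (rule derivative_eq_intros d\<gamma> refl | simp)+
  have dN: "(N has_real_derivative M g) (at g)" for g
    unfolding M_def N_def
    by (rule DERIV_sum) (rule derivative_eq_intros d\<Phi>' refl | simp)+
  have dA1: "(A1 has_real_derivative R g - A2 g) (at g)" for g
    unfolding A1_def R_def A2_def sum_subtractf[symmetric]
    by (rule DERIV_sum) (rule derivative_eq_intros d\<gamma> refl | simp add: algebra_simps power2_eq_square)+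
  have ds: "(s has_real_derivative s' g) (at g)" for g
    unfolding s_def[abs_def]
    by (rule derivative_eq_intros dN dR refl | use R_pos[of g] in \<open>simp add: s'_def s_def field_simps\<close>)+
  have dP: "((\<lambda>g. \<Sum>x\<in>X. (c x - p x * (f x)\<^sup>2) * \<Phi> (g - a x)) has_real_derivative C g - F g) (at g)" for g
    unfolding C_def F_def sum_subtractf[symmetric]
    by (rule DERIV_sum) (rule derivative_eq_intros d\<Phi>' refl | simp add: algebra_simps)+
  have dH: "(H has_real_derivative
      C g - F g - (2 * s' g * M g - 2 * s g * B1 g - 2 * s g * s' g * A1 g - (s g)\<^sup>2 * (R g - A2 g))) (at g)" for g
    unfolding H_def
    by (rule derivative_eq_intros dP ds dM dA1 refl | simp add: algebra_simps)+
  have dH_nonneg: "0 \<le> C g - F g - (2 * s' g * M g - 2 * s g * B1 g - 2 * s g * s' g * A1 g - (s g)\<^sup>2 * (R g - A2 g))" for g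
  proof -
    obtain b where b: "(\<Sum>x\<in>X. p x * \<gamma> g x * (f x + s g * a x - b)\<^sup>2) \<le> (s g)\<^sup>2 * R g + C g"
      using hyp[of g "s g"] unfolding \<gamma>_def R_def C_def by blast
    \<comment> \<open>Since \<open>f x + s * a x - b = f x - s * (g - a x) + (s * g - b)\<close>,
      this is the constant left over when everything is expressed through
      \<open>g - a x\<close>.\<close>
    define \<beta> where "\<beta> = s g * g - b"
    have eq: "(\<Sum>x\<in>X. p x * \<gamma> g x * (f x + s g * a x - b)\<^sup>2)
        = F g - 2 * s g * B1 g + (s g)\<^sup>2 * A2 g + 2 * \<beta> * (M g - s g * A1 g) + \<beta>\<^sup>2 * R g"
      unfolding F_def B1_def A2_def M_def A1_def R_def sum_distrib_left sum_subtractf[symmetric] sum.distrib[symmetric]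
      by (rule sum.cong) (auto simp: \<beta>_def power2_eq_square algebra_simps)
    \<comment> \<open>This is the derivative of \<open>s * R = - N\<close>.\<close>
    have s'_eq: "M g - s g * A1 g = - (s' g * R g)"
      using R_pos[of g] by (simp add: s'_def)
    have "2 * s' g * M g - 2 * s g * s' g * A1 g = 2 * s' g * (M g - s g * A1 g)"
      by (simp add: algebra_simps)
    also have "\<dots> = 2 * s' g * - (s' g * R g)" by (simp only: s'_eq)
    finally have "2 * s' g * M g - 2 * s g * s' g * A1 g = 2 * s' g * - (s' g * R g)" .
    moreover have "F g - 2 * s g * B1 g + (s g)\<^sup>2 * A2 g + 2 * \<beta> * - (s' g * R g) + \<beta>\<^sup>2 * R g \<le> (s g)\<^sup>2 * R g + C g"
      using b unfolding eq s'_eq .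
    \<comment> \<open>Inserting the two previous facts into the goal leaves
      \<open>\<beta>\<^sup>2 - 2 \<beta> s' + 2 s'\<^sup>2\<close> times \<open>R\<close>, which is
      this sum of squares.\<close>
    moreover have "0 \<le> ((\<beta> - s' g)\<^sup>2 + (s' g)\<^sup>2) * R g"
      using R_pos[of g] by simp
    ultimately show ?thesis by (simp add: algebra_simps power2_eq_square)
  qed
  have H_mono: "H x \<le> H y" if "x \<le> y" for x y
    by (rule DERIV_nonneg_imp_nondecreasing[OF that]) (use dH dH_nonneg in blast)
  define K where "K = (\<Sum>x\<in>X. \<bar>f x\<bar>)"
  have fK: "\<bar>f x\<bar> \<le> K" if "x \<in> X" for x
    unfolding K_def using fin that by (intro member_le_sum) auto
  \<comment> \<open>Centring of \<open>f\<close> allows any constant \<open>l\<close> to be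
    subtracted from \<open>\<Phi>\<close>; with 0 on the left and \<open>\<kappa>\<close> on the
    right, the tail bounds give \<open>\<bar>N g\<bar> \<le> K * R g\<close>.\<close>
  have s_bound: "\<bar>s g\<bar> \<le> K" if *: "\<And>x. x \<in> X \<Longrightarrow> \<bar>\<Phi> (g - a x) - l\<bar> \<le> \<gamma> g x" for g l
  proof -
    have "N g = (\<Sum>x\<in>X. p x * f x * (\<Phi> (g - a x) - l))"
      unfolding N_def right_diff_distrib sum_subtractf sum_distrib_right[symmetric] centred by simp
    also have "\<bar>\<dots>\<bar> \<le> (\<Sum>x\<in>X. p x * K * \<gamma> g x)"
      by (rule order_trans[OF sum_abs], rule sum_mono, unfold abs_mult, intro mult_mono)
        (use p fK * in \<open>auto simp: abs_of_pos less_imp_le intro!: mult_nonneg_nonneg order_trans[OF abs_ge_zero fK]\<close>)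
    also have "\<dots> = K * R g" unfolding R_def sum_distrib_left by (simp add: mult_ac)
    finally show ?thesis using R_pos[of g] by (simp add: s_def abs_divide divide_le_eq)
  qed
  \<comment> \<open>\<open>M\<close> and \<open>A1\<close> tend to 0 while \<open>s\<close> stays
    bounded; the filter \<open>G\<close> stands for either end.\<close>
  have lim: "((\<lambda>g. 2 * s g * M g - (s g)\<^sup>2 * A1 g) \<longlongrightarrow> 0) G"
    if G: "\<And>a. filterlim (\<lambda>g::real. g - a) G G"
      and g0: "((\<lambda>x::real. exp (- x\<^sup>2 / 2)) \<longlongrightarrow> 0) G"
      and g1: "((\<lambda>x::real. x * exp (- x\<^sup>2 / 2)) \<longlongrightarrow> 0) G"
      and sb: "\<forall>\<^sub>F g in G. \<bar>s g\<bar> \<le> K" for G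
  proof -
    have "((\<lambda>g. \<gamma> g x) \<longlongrightarrow> 0) G" for x
      unfolding \<gamma>_def using filterlim_compose[OF g0 G] .
    then have M0: "(M \<longlongrightarrow> 0) G" unfolding M_def by (intro tendsto_null_sum tendsto_mult_right_zero)
    have "((\<lambda>g. (g - a x) * \<gamma> g x) \<longlongrightarrow> 0) G" for x
      unfolding \<gamma>_def using filterlim_compose[OF g1 G] .
    then have A0: "(A1 \<longlongrightarrow> 0) G" unfolding A1_def by (intro tendsto_null_sum tendsto_mult_right_zero)
    have sM: "((\<lambda>g. s g * M g) \<longlongrightarrow> 0) G"
    proof (rule Lim_null_comparison)
      show "\<forall>\<^sub>F g in G. norm (s g * M g) \<le> K * \<bar>M g\<bar>"
        using sb by eventually_elim (simp add: abs_mult mult_right_mono)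
      show "((\<lambda>g. K * \<bar>M g\<bar>) \<longlongrightarrow> 0) G" by (intro tendsto_mult_right_zero tendsto_rabs_zero M0)
    qed
    have sA: "((\<lambda>g. (s g)\<^sup>2 * A1 g) \<longlongrightarrow> 0) G"
    proof (rule Lim_null_comparison)
      show "\<forall>\<^sub>F g in G. norm ((s g)\<^sup>2 * A1 g) \<le> K\<^sup>2 * \<bar>A1 g\<bar>"
        using sb by eventually_elim (auto simp: abs_mult intro!: mult_right_mono dest: power_mono[of _ _ 2])
      show "((\<lambda>g. K\<^sup>2 * \<bar>A1 g\<bar>) \<longlongrightarrow> 0) G" by (intro tendsto_mult_right_zero tendsto_rabs_zero A0)
    qed
    show ?thesis using tendsto_diff[OF tendsto_mult_right_zero[OF sM, of 2] sA] by (simp add: mult.assoc)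
  qed
  have "\<forall>\<^sub>F g in at_bot. \<forall>x\<in>X. g - a x \<le> - 1"
    using filterlim_diff_const(2) by (auto simp: eventually_ball_finite_distrib fin filterlim_at_bot)
  then have "\<forall>\<^sub>F g in at_bot. \<bar>s g\<bar> \<le> K"
    by eventually_elim (rule s_bound[of _ 0], use gaussian_tail_bot[OF d\<Phi> bot] in \<open>simp add: \<gamma>_def\<close>)
  note lim_bot = lim[OF filterlim_diff_const(2) tendsto_gaussian(2,4) this]
  have "\<forall>\<^sub>F g in at_top. \<forall>x\<in>X. 1 \<le> g - a x"
    using filterlim_diff_const(1) by (auto simp: eventually_ball_finite_distrib fin filterlim_at_top)
  then have "\<forall>\<^sub>F g in at_top. \<bar>s g\<bar> \<le> K"
    by eventually_elim (rule s_bound[of _ \<kappa>], use gaussian_tail_top[OF d\<Phi> top] in \<open>simp add: \<gamma>_def\<close>)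
  note lim_top = lim[OF filterlim_diff_const(1) tendsto_gaussian(1,3) this]
  have H_bot: "(H \<longlongrightarrow> (\<Sum>x\<in>X. (c x - p x * (f x)\<^sup>2) * 0) - 0) at_bot"
    unfolding H_def
    by (intro tendsto_diff tendsto_sum tendsto_mult tendsto_const lim_bot
        filterlim_compose[OF bot filterlim_diff_const(2)])
  have H_top: "(H \<longlongrightarrow> (\<Sum>x\<in>X. (c x - p x * (f x)\<^sup>2) * \<kappa>) - 0) at_top"
    unfolding H_def
    by (intro tendsto_diff tendsto_sum tendsto_mult tendsto_const lim_top
        filterlim_compose[OF top filterlim_diff_const(1)])
  have "\<forall>\<^sub>F g in at_bot. H g \<le> H 0"
    using eventually_le_at_bot[of 0] by eventually_elim (rule H_mono)
  then have "0 \<le> H 0" using tendsto_upperbound[OF H_bot, of "H 0"] by simp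
  moreover have "\<forall>\<^sub>F g in at_top. H 0 \<le> H g"
    using eventually_ge_at_top[of 0] by eventually_elim (rule H_mono)
  then have "H 0 \<le> (\<Sum>x\<in>X. c x - p x * (f x)\<^sup>2) * \<kappa>"
    using tendsto_lowerbound[OF H_top, of "H 0"] by (simp add: sum_distrib_right)
  \<comment> \<open>Monotonicity places \<open>H 0\<close> between the limit 0 at
    \<open>at_bot\<close> and the limit at \<open>at_top\<close>, which is \<open>\<kappa>\<close>
    times the desired difference.\<close>
  ultimately have "0 \<le> (\<Sum>x\<in>X. c x - p x * (f x)\<^sup>2) * \<kappa>" by linarith
  then show ?thesis using \<kappa> by (simp add: zero_le_mult_iff sum_subtractf)
qed

text \<open>Reduction to the centred case: subtracting the weighted mean \<open>m\<close> from
  \<open>f\<close> is absorbed by shifting \<open>b\<close> in the hypothesis.\<close>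

lemma gaussian_mixture_variance:
  fixes p a f c :: "'a \<Rightarrow> real"
  assumes fin: "finite X" "X \<noteq> {}" and p: "\<And>x. x \<in> X \<Longrightarrow> 0 < p x"
    and hyp: "\<And>g s. \<exists>b. (\<Sum>x\<in>X. p x * exp (- (g - a x)\<^sup>2 / 2) * (f x + s * a x - b)\<^sup>2)
      \<le> s\<^sup>2 * (\<Sum>x\<in>X. p x * exp (- (g - a x)\<^sup>2 / 2)) + (\<Sum>x\<in>X. c x * exp (- (g - a x)\<^sup>2 / 2))"
  shows "\<exists>b. (\<Sum>x\<in>X. p x * (f x - b)\<^sup>2) \<le> (\<Sum>x\<in>X. c x)"
proof -
  define m where "m = (\<Sum>x\<in>X. p x * f x) / (\<Sum>x\<in>X. p x)"
  have "0 < (\<Sum>x\<in>X. p x)" using fin p by (intro sum_pos) auto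
  then have "(\<Sum>x\<in>X. p x * (f x - m)) = 0"
    by (simp add: right_diff_distrib sum_subtractf sum_distrib_right[symmetric])
      (simp add: m_def)
  moreover have "\<exists>b. (\<Sum>x\<in>X. p x * exp (- (g - a x)\<^sup>2 / 2) * (f x - m + s * a x - b)\<^sup>2)
      \<le> s\<^sup>2 * (\<Sum>x\<in>X. p x * exp (- (g - a x)\<^sup>2 / 2)) + (\<Sum>x\<in>X. c x * exp (- (g - a x)\<^sup>2 / 2))" for g s
  proof -
    obtain b where "(\<Sum>x\<in>X. p x * exp (- (g - a x)\<^sup>2 / 2) * (f x + s * a x - b)\<^sup>2)
      \<le> s\<^sup>2 * (\<Sum>x\<in>X. p x * exp (- (g - a x)\<^sup>2 / 2)) + (\<Sum>x\<in>X. c x * exp (- (g - a x)\<^sup>2 / 2))"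
      using hyp by blast
    then show ?thesis by (intro exI[of _ "b - m"]) (simp add: algebra_simps)
  qed
  ultimately have "(\<Sum>x\<in>X. p x * (f x - m)\<^sup>2) \<le> (\<Sum>x\<in>X. c x)"
    using gaussian_mixture_variance_centred[where f="\<lambda>x. f x - m" and p=p and a=a and c=c and X=X] fin p by blast
  then show ?thesis ..
qed

section \<open>Dirichlet forms on the cube\<close>

definition flip :: "'n \<Rightarrow> real^'n \<Rightarrow> real^'n" where
  "flip i x = (\<chi> j. if j = i then - x $ j else x $ j)"

text \<open>On the cube, this is the conditional expectation of \<open>F\<close> given all coordinates but \<open>i\<close>, for the
  measure with weights \<open>w\<close>.\<close>

definition avg :: "(real^'n \<Rightarrow> real) \<Rightarrow> 'n \<Rightarrow> (real^'n \<Rightarrow> real) \<Rightarrow> real^'n \<Rightarrow> real" where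
  "avg w i F x = (w x * F x + w (flip i x) * F (flip i x)) / (w x + w (flip i x))"

text \<open>The heat-bath Dirichlet form: the sum over sites of the expected conditional variance,
  for an unnormalised weight.\<close>

definition dirichlet :: "(real^'n \<Rightarrow> real) \<Rightarrow> (real^'n \<Rightarrow> real) \<Rightarrow> real" where
  "dirichlet w F = (\<Sum>i\<in>UNIV. \<Sum>x\<in>cube. w x * (F x - avg w i F x)\<^sup>2)"

section \<open>Flips, the cube and conditional means\<close>

lemma flip_component: "flip i x $ j = (if j = i then - x $ j else x $ j)"
  by (simp add: flip_def)

lemma flip_flip [simp]: "flip i (flip i x) = x"
  by (simp add: vec_eq_iff flip_component)

lemma flip_commute: "flip i (flip j x) = flip j (flip i x)"
  by (simp add: vec_eq_iff flip_component)

lemma flip_in_cube [simp]: "flip i x \<in> cube \<longleftrightarrow> x \<in> cube"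
  by (auto simp: cube_def flip_component)

lemma cube_eq_image: "(cube :: (real^'n) set) = vec_lambda ` (PiE UNIV (\<lambda>_. {-1, 1}))"
proof (intro equalityI subsetI)
  fix x :: "real^'n" assume "x \<in> cube"
  then have "vec_nth x \<in> PiE UNIV (\<lambda>_. {-1, 1})" by (auto simp: cube_def)
  then show "x \<in> vec_lambda ` (PiE UNIV (\<lambda>_. {-1, 1}))" by (metis image_eqI vec_nth_inverse)
qed (auto simp: cube_def PiE_def Pi_def)

lemma finite_cube [simp]: "finite (cube :: (real^'n) set)"
  unfolding cube_eq_image by (intro finite_imageI finite_PiE) auto

lemma card_cube_le: "real (card (cube :: (real^'n) set)) \<le> 2 ^ CARD('n)"
proof -
  have "card (cube :: (real^'n) set) \<le> card (PiE (UNIV :: 'n set) (\<lambda>_. {-1, 1 :: real}))"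
    unfolding cube_eq_image by (intro card_image_le finite_PiE) auto
  also have "\<dots> = 2 ^ CARD('n)" by (simp add: card_PiE numeral_2_eq_2)
  finally show ?thesis by (metis of_nat_le_iff of_nat_numeral of_nat_power)
qed

lemma cube_nonempty [simp]: "(cube :: (real^'n) set) \<noteq> {}"
proof -
  have "(\<chi> i. 1) \<in> (cube :: (real^'n) set)" by (simp add: cube_def)
  then show ?thesis by blast
qed

lemma cube_component_sq: "x \<in> cube \<Longrightarrow> (x $ i)\<^sup>2 = 1"
  unfolding cube_def by (cases "x $ i = 1") force+

lemma sum_flip: "(\<Sum>x\<in>cube. G (flip i x)) = (\<Sum>x\<in>cube. G x)"
  by (rule sum.reindex_bij_witness[of _ "flip i" "flip i"]) auto

lemma avg_flip: "avg w i F (flip i x) = avg w i F x"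
  by (simp add: avg_def add.commute)

lemma avg_diff: "avg w i (\<lambda>x. F x - G x) x = avg w i F x - avg w i G x"
  by (simp add: avg_def diff_divide_distrib[symmetric] algebra_simps)

lemma avg_add: "avg w i (\<lambda>x. F x + G x) x = avg w i F x + avg w i G x"
  by (simp add: avg_def add_divide_distrib[symmetric] algebra_simps)

text \<open>The weighted residual of a conditional mean sums to zero over each pair
  \<open>x\<close>, \<open>flip i x\<close>, and \<open>G\<close> is constant on such pairs.\<close>

lemma avg_orthogonal:
  fixes w :: "real^'n \<Rightarrow> real"
  assumes w: "\<And>x. 0 < w x" and G: "\<And>x. G (flip i x) = G x"
  shows "(\<Sum>x\<in>cube. w x * (F x - avg w i F x) * G x) = 0"
proof -
  let ?T = "\<lambda>x. w x * (F x - avg w i F x) * G x"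
  have "?T x + ?T (flip i x) = 0" for x
  proof -
    have "w x + w (flip i x) \<noteq> 0" using w[of x] w[of "flip i x"] by linarith
    then have "w x * F x + w (flip i x) * F (flip i x) = avg w i F x * (w x + w (flip i x))"
      by (simp add: avg_def)
    then have "(w x * (F x - avg w i F x) + w (flip i x) * (F (flip i x) - avg w i F x)) * G x = 0"
      by (simp add: algebra_simps)
    then show ?thesis by (simp add: G avg_flip algebra_simps)
  qed
  then have "(\<Sum>x\<in>cube. ?T x + ?T (flip i x)) = 0" by simp
  then show ?thesis unfolding sum.distrib sum_flip[of ?T] by simp
qed

lemma avg_pythagoras:
  fixes w :: "real^'n \<Rightarrow> real"
  assumes w: "\<And>x. 0 < w x" and G: "\<And>x. G (flip i x) = G x"
  shows "(\<Sum>x\<in>cube. w x * (F x - G x)\<^sup>2)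
    = (\<Sum>x\<in>cube. w x * (F x - avg w i F x)\<^sup>2) + (\<Sum>x\<in>cube. w x * (avg w i F x - G x)\<^sup>2)"
proof -
  have "(\<Sum>x\<in>cube. w x * (F x - G x)\<^sup>2) = (\<Sum>x\<in>cube. w x * (F x - avg w i F x)\<^sup>2
      + w x * (avg w i F x - G x)\<^sup>2 + 2 * (w x * (F x - avg w i F x) * (avg w i F x - G x)))"
    by (rule sum.cong) (auto simp: power2_eq_square algebra_simps)
  then show ?thesis
    using avg_orthogonal[where w=w and G="\<lambda>x. avg w i F x - G x" and i=i and F=F] w
    by (simp add: sum.distrib sum_distrib_left[symmetric] avg_flip G)
qed

text \<open>This bounds \<open>dirichlet\<close> from above: any function constant on the pairs may
  replace the exact conditional mean.\<close>

lemma avg_minimises: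
  fixes w :: "real^'n \<Rightarrow> real"
  assumes w: "\<And>x. 0 < w x" and G: "\<And>x. G (flip i x) = G x"
  shows "(\<Sum>x\<in>cube. w x * (F x - avg w i F x)\<^sup>2) \<le> (\<Sum>x\<in>cube. w x * (F x - G x)\<^sup>2)"
proof -
  have "0 \<le> (\<Sum>x\<in>cube. w x * (avg w i F x - G x)\<^sup>2)"
    using w by (intro sum_nonneg) (simp add: less_imp_le)
  then show ?thesis using avg_pythagoras[where w=w and i=i and G=G and F=F, OF w G] by linarith
qed

section \<open>Efron-Stein inequality for product weights\<close>

lemma flip_invariant_const:
  fixes b :: "real^'n \<Rightarrow> 'a"
  assumes b: "\<And>x i. b (flip i x) = b x" and "x \<in> cube" "y \<in> cube"
  shows "b x = b y"
proof -
  \<comment> \<open>Induction on a set \<open>S\<close> of coordinates where the two points may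
    differ; each step flips at most one of them.\<close>
  have "b x = b y" if "finite S" "\<forall>j. j \<notin> S \<longrightarrow> x $ j = y $ j" "x \<in> cube" "y \<in> cube" for S x y
    using that
  proof (induction S arbitrary: y rule: finite_induct)
    case empty
    then have "x = y" by (simp add: vec_eq_iff)
    then show ?case by simp
  next
    case (insert i S)
    show ?case
    proof (cases "x $ i = y $ i")
      case True
      then have "\<forall>j. j \<notin> S \<longrightarrow> x $ j = y $ j" using insert.prems(1) by (metis insert_iff)
      then show ?thesis using insert.prems(2,3) by (rule insert.IH)
    next
      case False
      moreover have "x $ i \<in> {-1, 1}" and "y $ i \<in> {-1, 1}" using insert.prems by (auto simp: cube_def)
      ultimately have "x $ i = - y $ i" by auto
      then have "\<forall>j. j \<notin> S \<longrightarrow> x $ j = flip i y $ j"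
        using insert.prems(1) by (metis flip_component insert_iff)
      then have "b x = b (flip i y)"
        by (rule insert.IH) (use insert.prems in simp_all)
      then show ?thesis by (simp add: b)
    qed
  qed
  from this[of UNIV x y] assms(2,3) show ?thesis by simp
qed

lemma inner_flip: "(h :: real^'n) \<bullet> flip i x = h \<bullet> x - 2 * (h $ i * x $ i)"
proof -
  have "h \<bullet> flip i x = (\<Sum>j\<in>UNIV. h $ j * x $ j - (if j = i then 2 * (h $ i * x $ i) else 0))"
    unfolding inner_vec_def by (rule sum.cong) (auto simp: flip_component)
  then show ?thesis by (simp add: sum_subtractf inner_vec_def)
qed

text \<open>\<open>b\<close> arises by averaging \<open>F\<close> over the coordinates in
  \<open>I\<close> one at a time; each averaging adds at most the expected conditional variance of
  \<open>F\<close> itself in that coordinate.\<close>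

lemma efron_stein_partial:
  fixes h :: "real^'n" and F :: "real^'n \<Rightarrow> real"
  defines "w \<equiv> \<lambda>x. exp (h \<bullet> x)"
  assumes "finite I"
  shows "\<exists>b. (\<forall>x. \<forall>j\<in>I. b (flip j x) = b x) \<and>
    (\<Sum>x\<in>cube. w x * (F x - b x)\<^sup>2) \<le> (\<Sum>i\<in>I. \<Sum>x\<in>cube. w x * (F x - avg w i F x)\<^sup>2)"
  using \<open>finite I\<close>
proof (induction I rule: finite_induct)
  case empty
  then show ?case by (intro exI[of _ F]) simp
next
  case (insert i I)
  then obtain b where b: "\<And>x j. j \<in> I \<Longrightarrow> b (flip j x) = b x"
    and le: "(\<Sum>x\<in>cube. w x * (F x - b x)\<^sup>2) \<le> (\<Sum>i\<in>I. \<Sum>x\<in>cube. w x * (F x - avg w i F x)\<^sup>2)"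
    by blast
  have w: "0 < w x" for x by (simp add: w_def)
  have "avg w i b (flip j x) = avg w i b x" if "j \<in> insert i I" for j x
  proof (cases "j = i")
    case True
    then show ?thesis by (simp add: avg_flip)
  next
    case False
    then have j: "j \<in> I" using that by simp
    \<comment> \<open>The weight is a product, so flipping \<open>j\<close> multiplies both weights
      of the \<open>i\<close>-pair by the same factor, which cancels in \<open>avg\<close>.\<close>
    define r where "r = exp (- 2 * (h $ j * x $ j))"
    have "w (flip j x) = r * w x"
      by (simp add: w_def r_def inner_flip exp_add[symmetric])
    moreover have "w (flip i (flip j x)) = r * w (flip i x)"
      using False by (simp add: w_def r_def inner_flip exp_add[symmetric] flip_component)
    moreover have "b (flip i (flip j x)) = b (flip i x)"
      using b[OF j, of "flip i x"] by (simp add: flip_commute)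
    ultimately have "avg w i b (flip j x)
        = (r * (w x * b x + w (flip i x) * b (flip i x))) / (r * (w x + w (flip i x)))"
      using b[OF j] by (simp add: avg_def algebra_simps)
    also have "\<dots> = avg w i b x" by (simp add: avg_def r_def)
    finally show ?thesis .
  qed
  moreover have "(\<Sum>x\<in>cube. w x * (F x - avg w i b x)\<^sup>2)
      \<le> (\<Sum>i\<in>insert i I. \<Sum>x\<in>cube. w x * (F x - avg w i F x)\<^sup>2)"
  proof -
    \<comment> \<open>Averaging is an L2 contraction; applied to \<open>F - b\<close> it keeps the
      error accumulated so far from growing.\<close>
    have "(\<Sum>x\<in>cube. w x * (avg w i F x - avg w i b x)\<^sup>2) \<le> (\<Sum>x\<in>cube. w x * (F x - b x)\<^sup>2)"
    proof -
      have "0 \<le> (\<Sum>x\<in>cube. w x * (F x - b x - avg w i (\<lambda>x. F x - b x) x)\<^sup>2)"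
        using w by (intro sum_nonneg) (simp add: less_imp_le)
      then show ?thesis
        using avg_pythagoras[where w=w and G="\<lambda>_. 0" and i=i and F="\<lambda>x. F x - b x", OF w]
        by (simp add: avg_diff)
    qed
    then show ?thesis
      using avg_pythagoras[where w=w and G="avg w i b" and i=i and F=F, OF w] le insert.hyps by (simp add: avg_flip)
  qed
  ultimately show ?case by blast
qed

lemma efron_stein:
  fixes h :: "real^'n" and F :: "real^'n \<Rightarrow> real"
  shows "\<exists>b. (\<Sum>x\<in>cube. exp (h \<bullet> x) * (F x - b)\<^sup>2) \<le> dirichlet (\<lambda>x. exp (h \<bullet> x)) F"
proof -
  obtain b where b: "\<And>x j. b (flip j x) = b x"
    and le: "(\<Sum>x\<in>cube. exp (h \<bullet> x) * (F x - b x)\<^sup>2) \<le> dirichlet (\<lambda>x. exp (h \<bullet> x)) F"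
    using efron_stein_partial[of UNIV h F] unfolding dirichlet_def by auto
  obtain z :: "real^'n" where z: "z \<in> cube" using cube_nonempty by blast
  have "b x = b z" if "x \<in> cube" for x using flip_invariant_const[of b x z, OF b that z] .
  then have "(\<Sum>x\<in>cube. exp (h \<bullet> x) * (F x - b x)\<^sup>2) = (\<Sum>x\<in>cube. exp (h \<bullet> x) * (F x - b z)\<^sup>2)"
    by (intro sum.cong) auto
  then show ?thesis using le by auto
qed

text \<open>The test function is \<open>v \<bullet> x\<close> with its \<open>i\<close>-th term
  removed; the residual \<open>v $ i * x $ i\<close> has constant square on the cube.\<close>

lemma dirichlet_linear_le:
  fixes w :: "real^'n \<Rightarrow> real"
  assumes w: "\<And>x. 0 < w x"
  shows "dirichlet w (\<lambda>x. v \<bullet> x) \<le> (v \<bullet> v) * (\<Sum>x\<in>cube. w x)"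
proof -
  have "(\<Sum>x\<in>cube. w x * (v \<bullet> x - avg w i (\<lambda>x. v \<bullet> x) x)\<^sup>2) \<le> (v $ i)\<^sup>2 * (\<Sum>x\<in>cube. w x)" for i
  proof -
    have "(\<Sum>x\<in>cube. w x * (v \<bullet> x - avg w i (\<lambda>x. v \<bullet> x) x)\<^sup>2)
        \<le> (\<Sum>x\<in>cube. w x * (v \<bullet> x - (v \<bullet> x - v $ i * x $ i))\<^sup>2)"
      by (rule avg_minimises[OF w]) (simp add: inner_flip flip_component)
    also have "\<dots> = (v $ i)\<^sup>2 * (\<Sum>x\<in>cube. w x)"
      unfolding sum_distrib_left by (rule sum.cong) (auto simp: cube_component_sq power_mult_distrib)
    finally show ?thesis .
  qed
  then have "dirichlet w (\<lambda>x. v \<bullet> x) \<le> (\<Sum>i\<in>UNIV. (v $ i)\<^sup>2 * (\<Sum>x\<in>cube. w x))"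
    unfolding dirichlet_def by (rule sum_mono)
  then show ?thesis by (simp add: inner_vec_def sum_distrib_right power2_eq_square)
qed

lemma square_add_weighted:
  fixes a b \<theta> :: real
  assumes "0 < \<theta>" "\<theta> < 1"
  shows "(a + b)\<^sup>2 \<le> a\<^sup>2 / (1 - \<theta>) + b\<^sup>2 / \<theta>"
proof -
  have "0 \<le> (\<theta> * a - (1 - \<theta>) * b)\<^sup>2" by simp
  then have "(a + b)\<^sup>2 * ((1 - \<theta>) * \<theta>) \<le> a\<^sup>2 * \<theta> + b\<^sup>2 * (1 - \<theta>)"
    by (simp add: power2_eq_square algebra_simps)
  moreover have "a\<^sup>2 / (1 - \<theta>) + b\<^sup>2 / \<theta> = (a\<^sup>2 * \<theta> + b\<^sup>2 * (1 - \<theta>)) / ((1 - \<theta>) * \<theta>)"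
    using assms by (simp add: add_frac_eq)
  ultimately show ?thesis using assms by (simp add: pos_le_divide_eq)
qed

lemma dirichlet_add_weighted:
  fixes w :: "real^'n \<Rightarrow> real"
  assumes w: "\<And>x. 0 < w x" and "0 < \<theta>" "\<theta> < 1"
  shows "dirichlet w (\<lambda>x. F x + G x) \<le> dirichlet w F / (1 - \<theta>) + dirichlet w G / \<theta>"
  unfolding dirichlet_def sum_divide_distrib sum.distrib[symmetric]
proof (intro sum_mono)
  fix i x
  have "w x * (F x + G x - avg w i (\<lambda>x. F x + G x) x)\<^sup>2
      = w x * ((F x - avg w i F x) + (G x - avg w i G x))\<^sup>2"
    by (simp add: avg_add algebra_simps)
  also have "\<dots> \<le> w x * ((F x - avg w i F x)\<^sup>2 / (1 - \<theta>) + (G x - avg w i G x)\<^sup>2 / \<theta>)"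
    by (intro mult_left_mono square_add_weighted assms less_imp_le[OF w])
  finally show "w x * (F x + G x - avg w i (\<lambda>x. F x + G x) x)\<^sup>2
      \<le> w x * (F x - avg w i F x)\<^sup>2 / (1 - \<theta>) + w x * (G x - avg w i G x)\<^sup>2 / \<theta>"
    by (simp add: algebra_simps)
qed

text \<open>Base case of the peeling, without interaction: Efron-Stein for
  \<open>F + v \<bullet> x\<close>, split with weights \<open>1 - \<theta>\<close> and
  \<open>\<theta>\<close>. The linear part then costs at most \<open>\<tau>\<close> per unit mass,
  and \<open>F\<close> the factor \<open>1 / (1 - \<theta>)\<close>.\<close>

lemma product_poincare:
  fixes h v :: "real^'n"
  assumes \<theta>: "0 \<le> \<theta>" "\<theta> < 1" and \<tau>: "0 \<le> \<tau>" and v: "v \<bullet> v \<le> \<tau> * \<theta>"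
  shows "\<exists>b. (\<Sum>x\<in>cube. exp (h \<bullet> x) * (F x + v \<bullet> x - b)\<^sup>2)
    \<le> \<tau> * (\<Sum>x\<in>cube. exp (h \<bullet> x)) + dirichlet (\<lambda>x. exp (h \<bullet> x)) F / (1 - \<theta>)"
proof (cases "\<theta> = 0")
  \<comment> \<open>The split would divide by zero here, but the hypothesis forces
    \<open>v = 0\<close>.\<close>
  case True
  then have "v = 0" using v inner_gt_zero_iff[of v] by (simp add: not_less[symmetric])
  moreover have "0 \<le> \<tau> * (\<Sum>x\<in>(cube :: (real^'n) set). exp (h \<bullet> x))" using \<tau> by (simp add: sum_nonneg)
  moreover obtain b where "(\<Sum>x\<in>cube. exp (h \<bullet> x) * (F x - b)\<^sup>2) \<le> dirichlet (\<lambda>x. exp (h \<bullet> x)) F"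
    using efron_stein[of h F] by blast
  ultimately show ?thesis using True by (intro exI[of _ b]) simp
next
  case False
  then have \<theta>': "0 < \<theta>" using \<theta> by simp
  let ?w = "\<lambda>x. exp (h \<bullet> x)"
  obtain b where "(\<Sum>x\<in>cube. ?w x * (F x + v \<bullet> x - b)\<^sup>2) \<le> dirichlet ?w (\<lambda>x. F x + v \<bullet> x)"
    using efron_stein[of h "\<lambda>x. F x + v \<bullet> x"] by blast
  also have "\<dots> \<le> dirichlet ?w F / (1 - \<theta>) + dirichlet ?w (\<lambda>x. v \<bullet> x) / \<theta>"
    by (rule dirichlet_add_weighted[OF _ \<theta>' \<theta>(2)]) simp
  also have "dirichlet ?w (\<lambda>x. v \<bullet> x) / \<theta> \<le> \<tau> * (\<Sum>x\<in>cube. ?w x)"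
  proof -
    have "dirichlet ?w (\<lambda>x. v \<bullet> x) \<le> (v \<bullet> v) * (\<Sum>x\<in>cube. ?w x)"
      by (rule dirichlet_linear_le) simp
    also have "\<dots> \<le> \<tau> * \<theta> * (\<Sum>x\<in>cube. ?w x)"
      by (intro mult_right_mono v sum_nonneg) simp
    finally show ?thesis using \<theta>' by (simp add: pos_divide_le_eq mult_ac)
  qed
  finally show ?thesis by (intro exI[of _ b]) (simp add: add.commute)
qed

section \<open>The Poincare inequality for Ising measures\<close>

lemma symmetric_matrix_inner:
  fixes J :: "real^'n^'n"
  assumes "transpose J = J"
  shows "x \<bullet> (J *v y) = y \<bullet> (J *v x)"
  by (metis assms dot_lmul_matrix inner_commute transpose_matrix_vector)

lemma psd_cauchy_schwarz:
  fixes J :: "real^'n^'n"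
  assumes sym: "transpose J = J" and psd: "\<And>y. 0 \<le> y \<bullet> (J *v y)"
  shows "(x \<bullet> (J *v y))\<^sup>2 \<le> (x \<bullet> (J *v x)) * (y \<bullet> (J *v y))"
proof -
  have *: "0 \<le> x \<bullet> (J *v x) + 2 * t * (x \<bullet> (J *v y)) + t\<^sup>2 * (y \<bullet> (J *v y))" for t
  proof -
    have "0 \<le> (x + t *\<^sub>R y) \<bullet> (J *v (x + t *\<^sub>R y))" by (rule psd)
    also have "\<dots> = x \<bullet> (J *v x) + 2 * t * (x \<bullet> (J *v y)) + t\<^sup>2 * (y \<bullet> (J *v y))"
      using symmetric_matrix_inner[OF sym, of y x]
      by (simp add: matrix_vector_right_distrib matrix_vector_mult_scaleR inner_add_left inner_add_right
          power2_eq_square algebra_simps)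
    finally show ?thesis .
  qed
  show ?thesis
  proof (cases "y \<bullet> (J *v y) = 0")
    case True
    have "x \<bullet> (J *v y) = 0"
    proof (rule ccontr)
      \<comment> \<open>This \<open>t\<close> makes the quadratic above, which is affine in
        \<open>t\<close> here, equal to -1.\<close>
      define t where "t = - (x \<bullet> (J *v x) + 1) / (2 * (x \<bullet> (J *v y)))"
      assume "x \<bullet> (J *v y) \<noteq> 0"
      then have "2 * t * (x \<bullet> (J *v y)) = - (x \<bullet> (J *v x) + 1)" by (simp add: t_def)
      then show False using *[of t] True by simp
    qed
    then show ?thesis using True by simp
  next
    case False
    then have pos: "0 < y \<bullet> (J *v y)" using psd[of y] by linarith
    have "0 \<le> x \<bullet> (J *v x) - (x \<bullet> (J *v y))\<^sup>2 / (y \<bullet> (J *v y))"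
      using *[of "- (x \<bullet> (J *v y)) / (y \<bullet> (J *v y))"] pos
      by (simp add: power2_eq_square field_simps)
    then show ?thesis using pos by (simp add: field_simps)
  qed
qed

lemma ising_weight_pos: "0 < ising_weight J h x"
  by (simp add: ising_weight_def)

text \<open>The supermartingale property: conditional means under \<open>p\<close> serve as test
  functions under the tilted weight. The right side is linear in \<open>r\<close>, the shape of the
  cost term in \<open>gaussian_mixture_variance\<close>.\<close>

lemma dirichlet_tilt_le:
  fixes p r :: "real^'n \<Rightarrow> real"
  assumes p: "\<And>x. 0 < p x" and r: "\<And>x. 0 < r x"
  shows "dirichlet (\<lambda>x. p x * r x) F \<le> (\<Sum>x\<in>cube. (p x * (\<Sum>i\<in>UNIV. (F x - avg p i F x)\<^sup>2)) * r x)"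
proof -
  have "dirichlet (\<lambda>x. p x * r x) F \<le> (\<Sum>i\<in>UNIV. \<Sum>x\<in>cube. p x * r x * (F x - avg p i F x)\<^sup>2)"
    unfolding dirichlet_def
    by (rule sum_mono, rule avg_minimises) (simp_all add: avg_flip p r)
  also have "\<dots> = (\<Sum>x\<in>cube. \<Sum>i\<in>UNIV. p x * r x * (F x - avg p i F x)\<^sup>2)"
    by (rule sum.swap)
  finally show ?thesis by (simp add: sum_distrib_left sum_distrib_right mult_ac)
qed

lemma dirichlet_scale:
  assumes "c \<noteq> 0"
  shows "dirichlet (\<lambda>x. c * w x) F = c * dirichlet w F"
proof -
  have "avg (\<lambda>x. c * w x) i F x = avg w i F x" for i x
  proof -
    have "avg (\<lambda>x. c * w x) i F x = (c * (w x * F x + w (flip i x) * F (flip i x))) / (c * (w x + w (flip i x)))"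
      by (simp only: avg_def distrib_left mult.assoc)
    then show ?thesis using assms by (simp add: avg_def)
  qed
  then show ?thesis by (simp add: dirichlet_def sum_distrib_left mult.assoc)
qed

text \<open>Cauchy-Schwarz for \<open>(sqrt \<tau>, s)\<close> and \<open>(sqrt e, b)\<close>. With
  \<open>a = v \<bullet> y\<close>, \<open>b = u \<bullet> y\<close> and
  \<open>e = \<theta> * (y \<bullet> y) - y \<bullet> (J *v y)\<close> it carries the cost condition
  through one peeling step, since removing \<open>u u\<^sup>T\<close> from \<open>J\<close> raises
  \<open>e\<close> by \<open>b\<^sup>2\<close>.\<close>

lemma rank_one_cost:
  fixes a b e \<tau> s :: real
  assumes "a\<^sup>2 \<le> \<tau> * e" "0 \<le> \<tau>" "0 \<le> e"
  shows "(a + s * b)\<^sup>2 \<le> (\<tau> + s\<^sup>2) * (e + b\<^sup>2)"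
proof -
  define P Q where "P = \<tau> * b\<^sup>2" and "Q = s\<^sup>2 * e"
  have PQ: "0 \<le> P" "0 \<le> Q" using assms by (simp_all add: P_def Q_def)
  have "(2 * a * (s * b))\<^sup>2 = 4 * (a\<^sup>2 * (s * b)\<^sup>2)"
    unfolding power_mult_distrib by simp
  also have "\<dots> \<le> 4 * (\<tau> * e * (s * b)\<^sup>2)"
    using mult_right_mono[OF assms(1), of "(s * b)\<^sup>2"] by simp
  also have "\<dots> = 4 * (P * Q)"
    unfolding P_def Q_def power_mult_distrib by simp
  also have "\<dots> \<le> (P + Q)\<^sup>2"
    using zero_le_power2[of "P - Q"] unfolding power2_sum power2_diff by linarith
  finally have "2 * a * (s * b) \<le> P + Q"
    by (rule power2_le_imp_le) (use PQ in simp)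
  moreover have "(a + s * b)\<^sup>2 = a\<^sup>2 + 2 * a * (s * b) + s\<^sup>2 * b\<^sup>2"
    unfolding power2_sum power_mult_distrib by simp
  moreover have "(\<tau> + s\<^sup>2) * (e + b\<^sup>2) = \<tau> * e + P + Q + s\<^sup>2 * b\<^sup>2"
    by (simp add: P_def Q_def distrib_left distrib_right)
  ultimately show ?thesis using assms(1) by linarith
qed

text \<open>The hypothesis on \<open>v\<close> and \<open>\<tau>\<close> says \<open>v v\<^sup>T \<preceq> \<tau> (\<theta> Id - J)\<close>. Splitting off a Cholesky
  factor \<open>u\<close> of \<open>J\<close> and observing \<open>u \<bullet> x\<close> under Gaussian noise leaves an Ising measure with
  interaction \<open>J - u u\<^sup>T\<close> and a random field, and turns \<open>v\<close>, \<open>\<tau>\<close> into \<open>v + s u\<close>, \<open>\<tau> + s\<^sup>2\<close>.\<close>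

lemma ising_poincare_tilted:
  fixes J :: "real^'n^'n" and h v :: "real^'n"
  assumes "transpose J = J" and "\<And>y. 0 \<le> y \<bullet> (J *v y)"
    and "\<And>y. y \<bullet> (J *v y) \<le> \<theta> * (y \<bullet> y)" and \<theta>: "0 \<le> \<theta>" "\<theta> < 1"
    and "0 \<le> \<tau>" and "\<And>y. (v \<bullet> y)\<^sup>2 \<le> \<tau> * (\<theta> * (y \<bullet> y) - y \<bullet> (J *v y))"
  shows "\<exists>b. (\<Sum>x\<in>cube. ising_weight J h x * (F x + v \<bullet> x - b)\<^sup>2)
    \<le> \<tau> * (\<Sum>x\<in>cube. ising_weight J h x) + dirichlet (ising_weight J h) F / (1 - \<theta>)"
  using assms(1-3,6,7)
\<comment> \<open>The measure counts nonzero diagonal entries; each peeling step clears at least one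
  of them.\<close>
proof (induction "card {i. J $ i $ i \<noteq> 0}" arbitrary: J h v \<tau> rule: less_induct)
  case less
  note sym = less.prems(1) and psd = less.prems(2) and le\<theta> = less.prems(3)
    and \<tau> = less.prems(4) and cost = less.prems(5)
  have diag: "axis i 1 \<bullet> (J *v axis j 1) = J $ i $ j" for i j and J :: "real^'n^'n"
    by (simp add: inner_axis' matrix_vector_mult_basis column_def)
  show ?case
  proof (cases "\<forall>i. J $ i $ i = 0")
    case True
    have "J $ i $ j = 0" for i j
      using psd_cauchy_schwarz[OF sym psd, of "axis i 1" "axis j 1"] True by (simp add: diag)
    then have J0: "J = 0" by (simp add: vec_eq_iff)
    have "(v \<bullet> v)\<^sup>2 \<le> \<tau> * (\<theta> * (v \<bullet> v))" using cost[of v] J0 by simp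
    then have "v \<bullet> v \<le> \<tau> * \<theta>"
    proof (cases "v = 0")
      case False
      then have "0 < v \<bullet> v" by simp
      then show ?thesis using \<open>(v \<bullet> v)\<^sup>2 \<le> \<tau> * (\<theta> * (v \<bullet> v))\<close> by (simp add: power2_eq_square)
    qed (use \<tau> \<theta> in simp)
    then show ?thesis
      using product_poincare[OF \<theta> \<tau>, of v h F] by (simp add: ising_weight_def[abs_def] J0)
  next
    case False
    then obtain k where k: "J $ k $ k \<noteq> 0" by blast
    then have kpos: "0 < J $ k $ k" using psd[of "axis k 1"] by (simp add: diag)
    \<comment> \<open>The \<open>k\<close>-th column, scaled so that
      \<open>u $ k * u $ k = J $ k $ k\<close>: subtracting \<open>u u\<^sup>T\<close> clears the
      \<open>k\<close>-th diagonal entry.\<close>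
    define u where "u = (1 / sqrt (J $ k $ k)) *\<^sub>R (J *v axis k 1)"
    define J' where "J' = (\<chi> i j. J $ i $ j - u $ i * u $ j)"
    have J'v: "J' *v y = J *v y - (u \<bullet> y) *\<^sub>R u" for y
      by (simp add: vec_eq_iff J'_def matrix_vector_mult_def inner_vec_def sum_subtractf sum_distrib_left algebra_simps)
    have q': "y \<bullet> (J' *v y) = y \<bullet> (J *v y) - (u \<bullet> y)\<^sup>2" for y
      by (simp add: J'v inner_diff_right power2_eq_square inner_commute)
    have sym': "transpose J' = J'"
      using sym by (simp add: J'_def transpose_def vec_eq_iff mult.commute)
    \<comment> \<open>Positivity of the Schur complement: Cauchy-Schwarz for the form
      \<open>J\<close> at \<open>y\<close> and \<open>axis k 1\<close>.\<close>
    have psd': "0 \<le> y \<bullet> (J' *v y)" for y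
    proof -
      have "(u \<bullet> y)\<^sup>2 = (y \<bullet> (J *v axis k 1))\<^sup>2 / J $ k $ k"
        using kpos by (simp add: u_def power_divide inner_commute)
      also have "\<dots> \<le> y \<bullet> (J *v y)"
        using psd_cauchy_schwarz[OF sym psd, of y "axis k 1"] kpos by (simp add: diag pos_divide_le_eq)
      finally show ?thesis by (simp add: q')
    qed
    have le\<theta>': "y \<bullet> (J' *v y) \<le> \<theta> * (y \<bullet> y)" for y
      using le\<theta>[of y] by (simp add: q' add_increasing2 diff_le_eq)
    have "{i. J' $ i $ i \<noteq> 0} \<subset> {i. J $ i $ i \<noteq> 0}"
    proof (rule psubsetI)
      show "{i. J' $ i $ i \<noteq> 0} \<subseteq> {i. J $ i $ i \<noteq> 0}"
      proof (rule Collect_mono, rule impI, rule notI)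
        fix i assume *: "J' $ i $ i \<noteq> 0" "J $ i $ i = 0"
        \<comment> \<open>A zero diagonal entry stays zero: the subtraction makes it at most 0,
          positivity at least 0.\<close>
        then have "J' $ i $ i \<le> 0" by (simp add: J'_def)
        moreover have "0 \<le> J' $ i $ i" using psd'[of "axis i 1"] by (simp add: diag)
        ultimately show False using * by simp
      qed
      have "u $ k = J $ k $ k / sqrt (J $ k $ k)" by (simp add: u_def matrix_vector_mult_basis column_def)
      then have "u $ k * u $ k = J $ k $ k" using kpos by simp
      then have "J' $ k $ k = 0" by (simp add: J'_def)
      then show "{i. J' $ i $ i \<noteq> 0} \<noteq> {i. J $ i $ i \<noteq> 0}" using k by blast
    qed
    then have card: "card {i. J' $ i $ i \<noteq> 0} < card {i. J $ i $ i \<noteq> 0}"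
      by (intro psubset_card_mono) auto
    define p where "p = ising_weight J h"
    have p: "0 < p x" for x by (simp add: p_def ising_weight_pos)
    \<comment> \<open>Pointwise form of the right-hand side: its sum over the cube is
      \<open>\<tau>\<close> times the mass plus
      \<open>dirichlet p F / (1 - \<theta>)\<close>.\<close>
    define c where "c x = \<tau> * p x + p x * (\<Sum>i\<in>UNIV. (F x - avg p i F x)\<^sup>2) / (1 - \<theta>)" for x
    have "\<exists>b. (\<Sum>x\<in>cube. p x * (F x + v \<bullet> x - b)\<^sup>2) \<le> (\<Sum>x\<in>cube. c x)"
    proof (rule gaussian_mixture_variance[where a="\<lambda>x. u \<bullet> x"])
      fix g s :: real
      define r where "r x = exp (- (g - u \<bullet> x)\<^sup>2 / 2)" for x
      have r: "0 < r x" for x by (simp add: r_def)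
      \<comment> \<open>In the expansion of \<open>(g - u \<bullet> x)\<^sup>2\<close> the cross
        term adds the field \<open>g u\<close>, the square of \<open>u \<bullet> x\<close> removes
        \<open>u u\<^sup>T\<close> from the interaction, and \<open>E\<close> cancels the remaining
        \<open>g\<^sup>2\<close>.\<close>
      define E where "E = exp (g\<^sup>2 / 2)"
      have E: "0 < E" by (simp add: E_def)
      have weight: "ising_weight J' (h + g *\<^sub>R u) = (\<lambda>x. E * (p x * r x))"
      proof
        fix x
        have "1 / 2 * (x \<bullet> (J' *v x)) + (h + g *\<^sub>R u) \<bullet> x
            = g\<^sup>2 / 2 + ((1 / 2 * (x \<bullet> (J *v x)) + h \<bullet> x) + - (g - u \<bullet> x)\<^sup>2 / 2)"
          by (simp add: q' inner_add_left power2_eq_square algebra_simps add_divide_distrib diff_divide_distrib)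
        then show "ising_weight J' (h + g *\<^sub>R u) x = E * (p x * r x)"
          unfolding ising_weight_def p_def r_def E_def exp_add[symmetric] by simp
      qed
      have "((v + s *\<^sub>R u) \<bullet> y)\<^sup>2 \<le> (\<tau> + s\<^sup>2) * (\<theta> * (y \<bullet> y) - y \<bullet> (J' *v y))" for y
        using rank_one_cost[OF cost \<tau>, of y s "u \<bullet> y"] le\<theta>[of y]
        by (simp add: inner_add_left q' algebra_simps)
      then obtain b where "(\<Sum>x\<in>cube. E * (p x * r x) * (F x + (v + s *\<^sub>R u) \<bullet> x - b)\<^sup>2)
          \<le> (\<tau> + s\<^sup>2) * (\<Sum>x\<in>cube. E * (p x * r x)) + dirichlet (\<lambda>x. E * (p x * r x)) F / (1 - \<theta>)"
        using less.hyps[OF card sym' psd' le\<theta>', of "\<tau> + s\<^sup>2" "v + s *\<^sub>R u" "h + g *\<^sub>R u"] \<tau>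
        unfolding weight by auto
      moreover have "(\<Sum>x\<in>cube. E * (p x * r x) * (F x + (v + s *\<^sub>R u) \<bullet> x - b)\<^sup>2)
          = E * (\<Sum>x\<in>cube. p x * r x * (F x + v \<bullet> x + s * (u \<bullet> x) - b)\<^sup>2)"
        by (simp add: sum_distrib_left inner_add_left algebra_simps)
      moreover have "(\<tau> + s\<^sup>2) * (\<Sum>x\<in>cube. E * (p x * r x)) + dirichlet (\<lambda>x. E * (p x * r x)) F / (1 - \<theta>)
          = E * ((\<tau> + s\<^sup>2) * (\<Sum>x\<in>cube. p x * r x) + dirichlet (\<lambda>x. p x * r x) F / (1 - \<theta>))"
        using E by (simp add: dirichlet_scale sum_distrib_left[symmetric] distrib_left mult.left_commute)
      ultimately have "(\<Sum>x\<in>cube. p x * r x * (F x + v \<bullet> x + s * (u \<bullet> x) - b)\<^sup>2)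
          \<le> (\<tau> + s\<^sup>2) * (\<Sum>x\<in>cube. p x * r x) + dirichlet (\<lambda>x. p x * r x) F / (1 - \<theta>)"
        using E by simp
      also have "dirichlet (\<lambda>x. p x * r x) F / (1 - \<theta>)
          \<le> (\<Sum>x\<in>cube. (p x * (\<Sum>i\<in>UNIV. (F x - avg p i F x)\<^sup>2)) * r x) / (1 - \<theta>)"
        using \<theta> by (intro divide_right_mono dirichlet_tilt_le p r) auto
      also have "(\<tau> + s\<^sup>2) * (\<Sum>x\<in>cube. p x * r x) + \<dots>
          = s\<^sup>2 * (\<Sum>x\<in>cube. p x * r x) + (\<Sum>x\<in>cube. c x * r x)"
      proof -
        have "c x * r x = \<tau> * (p x * r x) + (p x * (\<Sum>i\<in>UNIV. (F x - avg p i F x)\<^sup>2)) * r x / (1 - \<theta>)" for x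
          by (simp add: c_def distrib_right)
        then show ?thesis
          by (simp only: sum.distrib sum_distrib_left[symmetric] sum_divide_distrib[symmetric])
            (simp add: distrib_right)
      qed
      finally have "(\<Sum>x\<in>cube. p x * r x * (F x + v \<bullet> x + s * (u \<bullet> x) - b)\<^sup>2)
          \<le> s\<^sup>2 * (\<Sum>x\<in>cube. p x * r x) + (\<Sum>x\<in>cube. c x * r x)" by simp
      then show "\<exists>b. (\<Sum>x\<in>cube. p x * exp (- (g - u \<bullet> x)\<^sup>2 / 2) * (F x + v \<bullet> x + s * (u \<bullet> x) - b)\<^sup>2)
          \<le> s\<^sup>2 * (\<Sum>x\<in>cube. p x * exp (- (g - u \<bullet> x)\<^sup>2 / 2))
            + (\<Sum>x\<in>cube. c x * exp (- (g - u \<bullet> x)\<^sup>2 / 2))"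
        unfolding r_def by blast
    qed (use p in auto)
    moreover have "(\<Sum>x\<in>cube. c x) = \<tau> * (\<Sum>x\<in>cube. p x) + dirichlet p F / (1 - \<theta>)"
    proof -
      have "dirichlet p F = (\<Sum>x\<in>cube. \<Sum>i\<in>UNIV. p x * (F x - avg p i F x)\<^sup>2)"
        unfolding dirichlet_def by (rule sum.swap)
      then show ?thesis
        by (simp add: c_def sum.distrib sum_distrib_left sum_divide_distrib)
    qed
    ultimately show ?thesis by (simp add: p_def)
  qed
qed

lemma ising_poincare:
  fixes J :: "real^'n^'n" and h :: "real^'n"
  assumes "transpose J = J" and "\<And>y. 0 \<le> y \<bullet> (J *v y)"
    and "\<And>y. y \<bullet> (J *v y) \<le> \<theta> * (y \<bullet> y)" and "0 \<le> \<theta>" "\<theta> < 1"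
  shows "\<exists>b. (1 - \<theta>) * (\<Sum>x\<in>cube. ising_weight J h x * (F x - b)\<^sup>2) \<le> dirichlet (ising_weight J h) F"
  using ising_poincare_tilted[OF assms, of 0 0 h F] assms(5)
  by (simp add: pos_le_divide_eq mult.commute)

section \<open>Glauber dynamics\<close>

text \<open>Cauchy-Schwarz at \<open>J *v y\<close> and \<open>y\<close> gives
  \<open>norm (J *v y) < norm y\<close>; strictness survives the supremum because it is attained on
  the unit sphere. This makes the rate \<open>1 - \<parallel>J\<parallel>\<close> positive.\<close>

lemma onorm_psd_contraction:
  fixes J :: "real^'n^'n"
  assumes sym: "transpose J = J" and psd: "\<And>y. 0 \<le> y \<bullet> (J *v y)"
    and less: "\<And>y. y \<noteq> 0 \<Longrightarrow> y \<bullet> (J *v y) < y \<bullet> y"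
  shows "onorm ((*v) J) < 1"
proof -
  have contr: "norm (J *v y) < norm y" if "y \<noteq> 0" for y
  proof (cases "J *v y = 0")
    case False
    define z where "z = J *v y"
    have pos: "0 < z \<bullet> z" "0 < y \<bullet> y" using False that by (simp_all add: z_def)
    have "(z \<bullet> z)\<^sup>2 \<le> (z \<bullet> (J *v z)) * (y \<bullet> (J *v y))"
      using psd_cauchy_schwarz[OF sym psd, of z y] by (simp add: z_def)
    also have "\<dots> < (z \<bullet> z) * (y \<bullet> y)"
      using psd less[of z] less[of y] False that by (intro mult_strict_mono') (auto simp: z_def)
    finally have "z \<bullet> z < y \<bullet> y" using pos by (simp add: power2_eq_square)
    then show ?thesis by (simp add: z_def norm_eq_sqrt_inner)
  qed (use that in simp)
  have "continuous_on (sphere 0 1) (\<lambda>y. norm (J *v y))"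
    by (intro continuous_on_norm linear_continuous_on matrix_vector_mul_bounded_linear)
  moreover have "sphere 0 1 \<noteq> ({} :: (real^'n) set)" by simp
  ultimately obtain y0 :: "real^'n" where y0: "y0 \<in> sphere 0 1"
    and max: "\<And>y. y \<in> sphere 0 1 \<Longrightarrow> norm (J *v y) \<le> norm (J *v y0)"
    using continuous_attains_sup[OF compact_sphere] by blast
  have "onorm ((*v) J) \<le> norm (J *v y0)"
  proof (rule onorm_le)
    fix x :: "real^'n"
    show "norm (J *v x) \<le> norm (J *v y0) * norm x"
    proof (cases "x = 0")
      case False
      have "norm (J *v ((1 / norm x) *\<^sub>R x)) \<le> norm (J *v y0)"
        using False by (intro max) simp
      then show ?thesis using False by (simp add: matrix_vector_mult_scaleR pos_divide_le_eq mult.commute)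
    qed simp
  qed
  also have "\<dots> < 1" using contr[of y0] y0 by (cases "y0 = 0") auto
  finally show ?thesis .
qed

section \<open>Ising measure and generator as finite sums\<close>

lemma density_point_measure:
  "density (point_measure A f) g = point_measure A (\<lambda>x. f x * g x)"
  unfolding point_measure_def by (rule density_density_eq) auto

lemma point_measure_cong:
  "(\<And>x. x \<in> A \<Longrightarrow> f x = g x) \<Longrightarrow> point_measure A f = point_measure A g"
  unfolding point_measure_def by (rule density_cong) (auto simp: AE_count_space)

lemma ising_measure_eq:
  fixes J :: "real^'n^'n" and h :: "real^'n"
  defines "w \<equiv> ising_weight J h"
  shows "ising_measure J h = point_measure cube (\<lambda>x. ennreal (w x / (\<Sum>y\<in>cube. w y)))"
proof -
  have S: "0 < (\<Sum>y\<in>cube. w y)" unfolding w_def by (intro sum_pos) (auto simp: ising_weight_pos)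
  have card: "0 < card (cube :: (real^'n) set)" by (simp add: card_gt_0_iff)
  have "ising_partition J h = (\<Sum>y\<in>cube. w y) / card (cube :: (real^'n) set)"
    unfolding ising_partition_def w_def by (rule integral_uniform_count_measure) simp
  moreover from this have "0 < ising_partition J h" using S card by simp
  ultimately have "ennreal (1 / card (cube :: (real^'n) set)) * ennreal (w x / ising_partition J h)
      = ennreal (w x / (\<Sum>y\<in>cube. w y))" for x
    using S card ising_weight_pos[of J h x]
    by (subst ennreal_mult[symmetric]) (auto simp: w_def field_simps intro!: divide_nonneg_nonneg)
  then show ?thesis
    unfolding ising_measure_def uniform_count_measure_def density_point_measure w_def by simp
qed

text \<open>Inside the cube the conditioning event is the pair \<open>x\<close>,
  \<open>flip i x\<close>, so the conditional expectation is \<open>avg\<close>; the normalisation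
  \<open>S\<close> cancels.\<close>

lemma glauber_generator_point_measure:
  fixes w :: "real^'n \<Rightarrow> real"
  assumes w: "\<And>x. 0 < w x" and S: "0 < S" and x: "x \<in> cube"
  shows "glauber_generator (point_measure cube (\<lambda>x. ennreal (w x / S))) \<phi> x
    = (\<Sum>i\<in>UNIV. avg w i \<phi> x - \<phi> x)"
proof -
  let ?\<nu> = "point_measure cube (\<lambda>x. ennreal (w x / S))"
  have "(\<integral>y. \<phi> y \<partial>uniform_measure ?\<nu> {y \<in> space ?\<nu>. \<forall>j. j \<noteq> i \<longrightarrow> y $ j = x $ j}) = avg w i \<phi> x" for i
  proof -
    have neq: "flip i x \<noteq> x"
    proof
      assume "flip i x = x"
      then have "x $ i = 0" by (metis flip_component neg_equal_zero)
      then show False using cube_component_sq[OF x, of i] by simp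
    qed
    have event: "{y \<in> space ?\<nu>. \<forall>j. j \<noteq> i \<longrightarrow> y $ j = x $ j} = {x, flip i x}"
    proof (intro equalityI subsetI)
      fix y assume "y \<in> {y \<in> space ?\<nu>. \<forall>j. j \<noteq> i \<longrightarrow> y $ j = x $ j}"
      then have y: "y \<in> cube" "\<And>j. j \<noteq> i \<Longrightarrow> y $ j = x $ j" by (auto simp: space_point_measure)
      have "y $ i \<in> {-1, 1}" and "x $ i \<in> {-1, 1}" using y(1) x by (simp_all add: cube_def)
      then have "y $ i = x $ i \<or> y $ i = - x $ i" by auto
      then show "y \<in> {x, flip i x}"
      proof
        assume "y $ i = x $ i"
        then have "y = x" using y(2) by (metis vec_eq_iff)
        then show ?thesis by simp
      next
        assume "y $ i = - x $ i"
        then have "y $ j = flip i x $ j" for j using y(2)[of j] by (simp add: flip_component)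
        then have "y = flip i x" by (simp add: vec_eq_iff)
        then show ?thesis by simp
      qed
    qed (use x in \<open>auto simp: space_point_measure flip_component\<close>)
    define T where "T = w x + w (flip i x)"
    have T: "0 < T" using w by (simp add: T_def add_pos_pos)
    have "emeasure ?\<nu> {x, flip i x} = ennreal (w x / S) + ennreal (w (flip i x) / S)"
      using x neq by (subst emeasure_point_measure_finite) auto
    also have "\<dots> = ennreal (T / S)"
      using w[of x] w[of "flip i x"] S
      by (subst ennreal_plus[symmetric]) (auto simp: T_def add_divide_distrib less_imp_le)
    finally have em: "emeasure ?\<nu> {x, flip i x} = ennreal (T / S)" .
    have "uniform_measure ?\<nu> {x, flip i x}
        = point_measure cube (\<lambda>y. ennreal (w y * indicator {x, flip i x} y / T))"
      unfolding uniform_measure_def density_point_measure em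
    proof (rule point_measure_cong)
      fix y
      have "ennreal (w y / S) * (indicator {x, flip i x} y / ennreal (T / S))
          = ennreal (w y / S) * (ennreal (indicator {x, flip i x} y) / ennreal (T / S))"
        by (simp add: indicator_def)
      also have "\<dots> = ennreal (w y / S * (indicator {x, flip i x} y / (T / S)))"
        using T S w[of y]
        by (subst divide_ennreal, simp, simp, subst ennreal_mult[symmetric]) (auto simp: less_imp_le)
      also have "w y / S * (indicator {x, flip i x} y / (T / S)) = w y * indicator {x, flip i x} y / T"
        using S by simp
      finally show "ennreal (w y / S) * (indicator {x, flip i x} y / ennreal (T / S))
          = ennreal (w y * indicator {x, flip i x} y / T)" .
    qed
    then have "(\<integral>y. \<phi> y \<partial>uniform_measure ?\<nu> {x, flip i x})
        = (\<Sum>y\<in>cube. (w y * indicator {x, flip i x} y / T) *\<^sub>R \<phi> y)"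
      using T w by (simp only:) (rule lebesgue_integral_point_measure_finite, auto simp: less_imp_le)
    also have "\<dots> = (\<Sum>y\<in>{x, flip i x}. w y * \<phi> y / T)"
      using x by (intro sum.mono_neutral_cong_right) auto
    also have "\<dots> = avg w i \<phi> x"
      using neq by (simp add: avg_def T_def add_divide_distrib)
    finally show ?thesis unfolding event .
  qed
  then show ?thesis by (simp add: glauber_generator_def)
qed

section \<open>The semigroup as a power series\<close>

lemma avg_bound:
  fixes w :: "real^'n \<Rightarrow> real"
  assumes w: "\<And>x. 0 < w x" and F: "\<bar>F x\<bar> \<le> C" "\<bar>F (flip i x)\<bar> \<le> C"
  shows "\<bar>avg w i F x\<bar> \<le> C"
proof -
  have "\<bar>w x * F x + w (flip i x) * F (flip i x)\<bar> \<le> w x * C + w (flip i x) * C"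
    using w[of x] w[of "flip i x"] F
    by (intro order_trans[OF abs_triangle_ineq] add_mono) (simp_all add: abs_mult)
  then show ?thesis
    using w[of x] w[of "flip i x"]
    by (simp add: avg_def abs_divide pos_divide_le_eq abs_of_pos[OF add_pos_pos] algebra_simps)
qed

lemma avg_mult_right: "avg w i (\<lambda>y. F y * c) x = avg w i F x * c"
  by (simp add: avg_def algebra_simps)

lemma avg_sums:
  assumes "(\<lambda>k. F k x) sums G x" "(\<lambda>k. F k (flip i x)) sums G (flip i x)"
  shows "(\<lambda>k. avg w i (F k) x) sums avg w i G x"
  unfolding avg_def by (intro sums_divide sums_add sums_mult assms)

text \<open>The backward equation, by termwise differentiation. \<open>L\<close> is prescribed on
  the cube only; flips preserve the cube, so this determines all iterates there.\<close>

lemma semigroup_derivative: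
  fixes w \<phi> :: "real^'n \<Rightarrow> real" and L :: "(real^'n \<Rightarrow> real) \<Rightarrow> real^'n \<Rightarrow> real"
  assumes w: "\<And>x. 0 < w x"
    and L: "\<And>F x. x \<in> cube \<Longrightarrow> L F x = (\<Sum>i\<in>UNIV. avg w i F x - F x)"
  defines "P \<equiv> \<lambda>t x. \<Sum>k. t ^ k / fact k * (L ^^ k) \<phi> x"
  assumes x: "x \<in> cube"
  shows "((\<lambda>t. P t x) has_real_derivative (\<Sum>i\<in>UNIV. avg w i (P t) x - P t x)) (at t)"
proof -
  define C where "C = (\<Sum>y\<in>(cube :: (real^'n) set). \<bar>\<phi> y\<bar>)"
  \<comment> \<open>Each site contributes at most twice the supremum, so \<open>D\<close> bounds the
    norm of \<open>L\<close> for the sup norm on the cube.\<close>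
  define D where "D = 2 * real CARD('n)"
  have D: "0 \<le> D" by (simp add: D_def)
  have bound: "\<bar>(L ^^ k) \<phi> y\<bar> \<le> D ^ k * C" if "y \<in> cube" for k y
    using that
  proof (induction k arbitrary: y)
    case 0
    then show ?case unfolding C_def by (auto intro!: member_le_sum[where f="\<lambda>y. \<bar>\<phi> y\<bar>"])
  next
    case (Suc k)
    have "\<bar>avg w i ((L ^^ k) \<phi>) y - (L ^^ k) \<phi> y\<bar> \<le> 2 * (D ^ k * C)" for i
    proof -
      have "\<bar>avg w i ((L ^^ k) \<phi>) y\<bar> \<le> D ^ k * C"
        by (rule avg_bound[OF w]) (use Suc in auto)
      then show ?thesis using Suc.IH[OF Suc.prems] by linarith
    qed
    then have "(\<Sum>i\<in>UNIV. \<bar>avg w i ((L ^^ k) \<phi>) y - (L ^^ k) \<phi> y\<bar>) \<le> (\<Sum>i\<in>(UNIV :: 'n set). 2 * (D ^ k * C))"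
      by (rule sum_mono)
    moreover have "\<bar>(L ^^ Suc k) \<phi> y\<bar> \<le> (\<Sum>i\<in>UNIV. \<bar>avg w i ((L ^^ k) \<phi>) y - (L ^^ k) \<phi> y\<bar>)"
      unfolding funpow.simps o_apply L[OF Suc.prems] by (rule sum_abs)
    ultimately have "\<bar>(L ^^ Suc k) \<phi> y\<bar> \<le> (\<Sum>i\<in>(UNIV :: 'n set). 2 * (D ^ k * C))"
      by linarith
    also have "\<dots> = D ^ Suc k * C" by (simp add: D_def)
    finally show ?case .
  qed
  define c where "c y k = (L ^^ k) \<phi> y / fact k" for y k
  have P: "P t y = (\<Sum>k. c y k * t ^ k)" for t y
    by (simp add: P_def c_def mult.commute)
  have summ: "summable (\<lambda>k. c y k * s ^ k)" if y: "y \<in> cube" for y s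
  proof (rule summable_comparison_test)
    have "summable (\<lambda>k. (D * \<bar>s\<bar>) ^ k /\<^sub>R fact k)" by (rule summable_exp_generic)
    from summable_mult[OF this, of C]
    show "summable (\<lambda>k. C * ((D * \<bar>s\<bar>) ^ k /\<^sub>R fact k))" .
    show "\<exists>N. \<forall>k\<ge>N. norm (c y k * s ^ k) \<le> C * ((D * \<bar>s\<bar>) ^ k /\<^sub>R fact k)"
    proof (intro exI allI impI)
      fix k
      have "norm (c y k * s ^ k) = \<bar>(L ^^ k) \<phi> y\<bar> * \<bar>s\<bar> ^ k / fact k"
        by (simp add: c_def abs_mult power_abs)
      also have "\<dots> \<le> (D ^ k * C) * \<bar>s\<bar> ^ k / fact k"
        by (intro divide_right_mono mult_right_mono bound y) auto
      also have "\<dots> = C * ((D * \<bar>s\<bar>) ^ k /\<^sub>R fact k)"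
        by (simp add: power_mult_distrib field_simps)
      finally show "norm (c y k * s ^ k) \<le> C * ((D * \<bar>s\<bar>) ^ k /\<^sub>R fact k)" .
    qed
  qed
  have sums: "(\<lambda>k. c y k * t ^ k) sums P t y" if "y \<in> cube" for y
    unfolding P using summ[OF that] by (rule summable_sums)
  have "(\<lambda>k. \<Sum>i\<in>UNIV. avg w i (\<lambda>y. c y k * t ^ k) x - c x k * t ^ k)
      sums (\<Sum>i\<in>UNIV. avg w i (P t) x - P t x)"
    using x by (intro sums_sum sums_diff avg_sums[where F="\<lambda>k y. c y k * t ^ k"] sums) auto
  \<comment> \<open>Differentiation turns \<open>fact (Suc k)\<close> into \<open>fact k\<close>, so
    the new coefficient is the generator applied to the old one of the same index.\<close>
  moreover have "(\<Sum>i\<in>UNIV. avg w i (\<lambda>y. c y k * t ^ k) x - c x k * t ^ k) = diffs (c x) k * t ^ k" for k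
  proof -
    have "diffs (c x) k = (L ^^ Suc k) \<phi> x * (1 / fact k)"
      by (simp add: diffs_def c_def field_simps del: of_nat_Suc)
    also have "\<dots> = (\<Sum>i\<in>UNIV. avg w i (\<lambda>y. c y k) x - c x k)"
      unfolding funpow.simps o_apply L[OF x] sum_distrib_right c_def
      by (simp add: diff_divide_distrib avg_mult_right[where c="1 / fact k", simplified])
    finally show ?thesis by (simp add: sum_distrib_right left_diff_distrib avg_mult_right)
  qed
  ultimately have "(\<Sum>k. diffs (c x) k * t ^ k) = (\<Sum>i\<in>UNIV. avg w i (P t) x - P t x)"
    by (simp add: sums_iff)
  then show ?thesis
    using termdiffs_strong_converges_everywhere[of "c x" t] summ[OF x] unfolding P by simp
qed

section \<open>Exponential decay of the variance\<close>

lemma mean_minimises: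
  fixes w F :: "'a \<Rightarrow> real"
  assumes "finite X" and "(\<Sum>x\<in>X. w x * (F x - m)) = 0" and w: "\<And>x. 0 \<le> w x"
  shows "(\<Sum>x\<in>X. w x * (F x - m)\<^sup>2) \<le> (\<Sum>x\<in>X. w x * (F x - b)\<^sup>2)"
proof -
  have "(\<Sum>x\<in>X. w x * (F x - b)\<^sup>2)
      = (\<Sum>x\<in>X. w x * (F x - m)\<^sup>2 + w x * (m - b)\<^sup>2 + 2 * (m - b) * (w x * (F x - m)))"
    by (rule sum.cong) (auto simp: power2_eq_square algebra_simps)
  also have "\<dots> = (\<Sum>x\<in>X. w x * (F x - m)\<^sup>2) + (\<Sum>x\<in>X. w x * (m - b)\<^sup>2)"
    by (simp add: sum.distrib sum_distrib_left[symmetric] assms(2))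
  moreover have "0 \<le> (\<Sum>x\<in>X. w x * (m - b)\<^sup>2)" using w by (intro sum_nonneg) simp
  ultimately show ?thesis by linarith
qed

text \<open>Invariance of \<open>w\<close> under the dynamics: residuals of \<open>avg\<close> are
  orthogonal to constants.\<close>

lemma sum_generator_eq_0:
  fixes w :: "real^'n \<Rightarrow> real"
  assumes w: "\<And>x. 0 < w x"
  shows "(\<Sum>x\<in>cube. w x * (\<Sum>i\<in>UNIV. avg w i F x - F x)) = 0"
proof -
  have "(\<Sum>x\<in>cube. w x * (\<Sum>i\<in>UNIV. avg w i F x - F x))
      = (\<Sum>i\<in>UNIV. \<Sum>x\<in>cube. w x * (avg w i F x - F x))"
    unfolding sum_distrib_left by (rule sum.swap)
  also have "\<dots> = 0"
  proof (rule sum.neutral, rule ballI)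
    fix i
    have "(\<Sum>x\<in>cube. w x * (avg w i F x - F x)) = - (\<Sum>x\<in>cube. w x * (F x - avg w i F x) * 1)"
      unfolding sum_negf[symmetric] by (rule sum.cong) (auto simp: algebra_simps)
    then show "(\<Sum>x\<in>cube. w x * (avg w i F x - F x)) = 0"
      using avg_orthogonal[where w=w and G="\<lambda>_. 1" and i=i and F=F, OF w] by simp
  qed
  finally show ?thesis .
qed

text \<open>Integration by parts: the residual is orthogonal to \<open>avg w i F - m\<close>, so the
  factor \<open>F - m\<close> may be replaced by \<open>F - avg w i F\<close>.\<close>

lemma sum_generator_eq_dirichlet:
  fixes w :: "real^'n \<Rightarrow> real"
  assumes w: "\<And>x. 0 < w x"
  shows "(\<Sum>x\<in>cube. w x * ((F x - m) * (\<Sum>i\<in>UNIV. avg w i F x - F x))) = - dirichlet w F"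
proof -
  have "(\<Sum>x\<in>cube. w x * ((F x - m) * (avg w i F x - F x))) = - (\<Sum>x\<in>cube. w x * (F x - avg w i F x)\<^sup>2)" for i
  proof -
    have "(\<Sum>x\<in>cube. w x * ((F x - m) * (avg w i F x - F x)))
        = (\<Sum>x\<in>cube. - (w x * (F x - avg w i F x)\<^sup>2) - w x * (F x - avg w i F x) * (avg w i F x - m))"
      by (rule sum.cong) (auto simp: power2_eq_square algebra_simps)
    then show ?thesis
      using avg_orthogonal[where w=w and G="\<lambda>x. avg w i F x - m" and i=i and F=F, OF w]
      by (simp add: sum_subtractf sum_negf avg_flip)
  qed
  moreover have "(\<Sum>x\<in>cube. w x * ((F x - m) * (\<Sum>i\<in>UNIV. avg w i F x - F x)))
      = (\<Sum>i\<in>UNIV. \<Sum>x\<in>cube. w x * ((F x - m) * (avg w i F x - F x)))"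
    unfolding sum_distrib_left by (rule sum.swap)
  ultimately show ?thesis by (simp add: dirichlet_def sum_negf)
qed

text \<open>Gronwall argument: the variance has derivative \<open>-2\<close> times the Dirichlet
  form, which the Poincare inequality bounds from below.\<close>

lemma semigroup_variance_decay:
  fixes w \<phi> :: "real^'n \<Rightarrow> real" and L :: "(real^'n \<Rightarrow> real) \<Rightarrow> real^'n \<Rightarrow> real"
  assumes w: "\<And>x. 0 < w x"
    and L: "\<And>F x. x \<in> cube \<Longrightarrow> L F x = (\<Sum>i\<in>UNIV. avg w i F x - F x)"
    and poincare: "\<And>F. \<exists>b. \<gamma> * (\<Sum>x\<in>cube. w x * (F x - b)\<^sup>2) \<le> dirichlet w F"
    and \<gamma>: "0 \<le> \<gamma>" and t: "0 \<le> t"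
    and m: "(\<Sum>x\<in>cube. w x * (\<phi> x - m)) = 0"
  defines "P \<equiv> \<lambda>t x. \<Sum>k. t ^ k / fact k * (L ^^ k) \<phi> x"
  shows "(\<Sum>x\<in>cube. w x * (P t x - m)\<^sup>2) \<le> exp (- 2 * \<gamma> * t) * (\<Sum>x\<in>cube. w x * (\<phi> x - m)\<^sup>2)"
proof -
  have dP: "((\<lambda>t. P t x) has_real_derivative (\<Sum>i\<in>UNIV. avg w i (P t) x - P t x)) (at t)"
    if "x \<in> cube" for x t
    unfolding P_def by (rule semigroup_derivative[where L=L and \<phi>=\<phi>]) (use w L that in auto)
  have P0: "P 0 x = \<phi> x" for x
    unfolding P_def using powser_zero[of "\<lambda>k. (L ^^ k) \<phi> x / fact k"] by (simp add: mult.commute)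
  \<comment> \<open>The mean is conserved, so \<open>m\<close> stays optimal and can replace the
    unspecified \<open>b\<close> of the Poincare inequality.\<close>
  have mean: "(\<Sum>x\<in>cube. w x * (P t x - m)) = 0" for t
  proof -
    have "((\<lambda>t. \<Sum>x\<in>cube. w x * (P t x - m)) has_real_derivative
        (\<Sum>x\<in>cube. w x * (\<Sum>i\<in>UNIV. avg w i (P t) x - P t x))) (at t)" for t
      by (rule DERIV_sum) (rule derivative_eq_intros dP refl | simp)+
    then have "((\<lambda>t. \<Sum>x\<in>cube. w x * (P t x - m)) has_real_derivative 0) (at t)" for t
      unfolding sum_generator_eq_0[OF w] .
    then have "(\<Sum>x\<in>cube. w x * (P t x - m)) = (\<Sum>x\<in>cube. w x * (P 0 x - m))"
      using DERIV_isconst_all[of "\<lambda>t. \<Sum>x\<in>cube. w x * (P t x - m)"] by blast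
    then show ?thesis by (simp add: P0 m)
  qed
  define V where "V t = (\<Sum>x\<in>cube. w x * (P t x - m)\<^sup>2)" for t
  have dV: "(V has_real_derivative - 2 * dirichlet w (P t)) (at t)" for t
  proof -
    have "(V has_real_derivative
        (\<Sum>x\<in>cube. 2 * (w x * ((P t x - m) * (\<Sum>i\<in>UNIV. avg w i (P t) x - P t x))))) (at t)"
      unfolding V_def by (rule DERIV_sum) (rule derivative_eq_intros dP refl | simp)+
    then show ?thesis
      unfolding sum_distrib_left[symmetric] sum_generator_eq_dirichlet[OF w] by simp
  qed
  have V_le: "\<gamma> * V t \<le> dirichlet w (P t)" for t
  proof -
    obtain b where "\<gamma> * (\<Sum>x\<in>cube. w x * (P t x - b)\<^sup>2) \<le> dirichlet w (P t)" using poincare by blast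
    moreover have "V t \<le> (\<Sum>x\<in>cube. w x * (P t x - b)\<^sup>2)"
      unfolding V_def by (rule mean_minimises) (use mean w in \<open>auto simp: less_imp_le\<close>)
    ultimately show ?thesis using mult_left_mono[OF _ \<gamma>] by fastforce
  qed
  have "exp (2 * \<gamma> * t) * V t \<le> exp (2 * \<gamma> * 0) * V 0"
  proof (rule DERIV_nonpos_imp_nonincreasing[OF t])
    fix s
    have "((\<lambda>t. exp (2 * \<gamma> * t) * V t) has_real_derivative
        exp (2 * \<gamma> * s) * (2 * (\<gamma> * V s - dirichlet w (P s)))) (at s)"
      by (rule derivative_eq_intros dV refl | simp add: algebra_simps)+
    moreover have "exp (2 * \<gamma> * s) * (2 * (\<gamma> * V s - dirichlet w (P s))) \<le> 0"
      using V_le[of s] by (simp add: mult_le_0_iff)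
    ultimately show "\<exists>y. ((\<lambda>t. exp (2 * \<gamma> * t) * V t) has_real_derivative y) (at s) \<and> y \<le> 0" by blast
  qed
  then have "exp (- 2 * \<gamma> * t) * (exp (2 * \<gamma> * t) * V t) \<le> exp (- 2 * \<gamma> * t) * V 0"
    by (intro mult_left_mono) simp_all
  moreover have "exp (- 2 * \<gamma> * t) * (exp (2 * \<gamma> * t) * V t) = V t"
    unfolding mult.assoc[symmetric] exp_add[symmetric] by simp
  ultimately have "V t \<le> exp (- 2 * \<gamma> * t) * V 0" by metis
  then show ?thesis by (simp only: V_def P0)
qed

section \<open>Crude mass bounds and total variation\<close>

lemma inner_cube_le:
  fixes h x :: "real^'n"
  assumes "x \<in> cube"
  shows "\<bar>h \<bullet> x\<bar> \<le> (\<Sum>i\<in>UNIV. \<bar>h $ i\<bar>)"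
proof -
  have "\<bar>x $ i\<bar> = 1" for i using cube_component_sq[OF assms, of i] by (simp add: abs_square_eq_1)
  then show ?thesis unfolding inner_vec_def
    by (intro order_trans[OF sum_abs] sum_mono) (simp add: abs_mult)
qed

lemma inner_cube_self:
  fixes x :: "real^'n"
  assumes "x \<in> cube"
  shows "x \<bullet> x = real CARD('n)"
  using cube_component_sq[OF assms] by (simp add: inner_vec_def power2_eq_square)

text \<open>On the cube the quadratic form lies between 0 and \<open>\<theta>\<close> times the
  dimension, and the field term varies by at most twice the l1 norm of \<open>h\<close>.\<close>

lemma ising_mass_ratio_le:
  fixes J :: "real^'n^'n" and h :: "real^'n"
  assumes psd: "\<And>y. 0 \<le> y \<bullet> (J *v y)" and le: "\<And>y. y \<bullet> (J *v y) \<le> \<theta> * (y \<bullet> y)"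
    and x: "x \<in> cube"
  shows "(\<Sum>y\<in>cube. ising_weight J h y)
    \<le> 2 ^ CARD('n) * exp (\<theta> * real CARD('n) / 2 + 2 * (\<Sum>i\<in>UNIV. \<bar>h $ i\<bar>)) * ising_weight J h x"
proof -
  define H where "H = (\<Sum>i\<in>UNIV. \<bar>h $ i\<bar>)"
  have "ising_weight J h y \<le> exp (\<theta> * real CARD('n) / 2 + H)" if "y \<in> cube" for y
    using inner_cube_le[OF that, of h] le[of y]
    by (simp add: ising_weight_def H_def inner_cube_self[OF that])
  then have "(\<Sum>y\<in>cube. ising_weight J h y)
      \<le> real (card (cube :: (real^'n) set)) * exp (\<theta> * real CARD('n) / 2 + H)"
    by (rule sum_bounded_above)
  also have "\<dots> \<le> 2 ^ CARD('n) * exp (\<theta> * real CARD('n) / 2 + H)"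
    by (intro mult_right_mono card_cube_le) simp
  also have "\<dots> = 2 ^ CARD('n) * exp (\<theta> * real CARD('n) / 2 + 2 * H) * exp (- H)"
    by (simp add: mult.assoc exp_add[symmetric])
  also have "\<dots> \<le> 2 ^ CARD('n) * exp (\<theta> * real CARD('n) / 2 + 2 * H) * ising_weight J h x"
    using inner_cube_le[OF x, of h] psd[of x]
    by (intro mult_left_mono) (simp_all add: ising_weight_def H_def)
  finally show ?thesis by (simp add: H_def)
qed

lemma measure_point_measure_ennreal:
  assumes "finite X" "A \<subseteq> X"
  shows "measure (point_measure X (\<lambda>x. ennreal (f x))) A = (\<Sum>x\<in>A. max 0 (f x))"
proof -
  have "point_measure X (\<lambda>x. ennreal (f x)) = point_measure X (\<lambda>x. ennreal (max 0 (f x)))"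
    by (rule point_measure_cong) (simp add: max_def ennreal_neg)
  moreover have "emeasure (point_measure X (\<lambda>x. ennreal (max 0 (f x)))) A = ennreal (\<Sum>x\<in>A. max 0 (f x))"
    unfolding emeasure_point_measure_finite[OF assms] by (rule sum_ennreal) simp
  ultimately show ?thesis by (simp add: measure_def sum_nonneg)
qed

text \<open>Since the second measure is nonnegative, cutting off negative parts of the first density, as
  \<^const>\<open>ennreal\<close> does, can only decrease the distance. Hence positivity of the semigroup is not
  an issue.\<close>

lemma tv_dist_point_measure_le:
  fixes f g :: "'a \<Rightarrow> real"
  assumes fin: "finite X" and g: "\<And>x. x \<in> X \<Longrightarrow> 0 \<le> g x"
  shows "tv_dist (point_measure X (\<lambda>x. ennreal (f x))) (point_measure X (\<lambda>x. ennreal (g x)))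
    \<le> (\<Sum>x\<in>X. \<bar>f x - g x\<bar>)"
  unfolding tv_dist_def
proof (rule cSUP_least)
  fix A assume "A \<in> sets (point_measure X (\<lambda>x. ennreal (f x)))"
  then have A: "A \<subseteq> X" by (simp add: sets_point_measure)
  have "\<bar>measure (point_measure X (\<lambda>x. ennreal (f x))) A - measure (point_measure X (\<lambda>x. ennreal (g x))) A\<bar>
      = \<bar>\<Sum>x\<in>A. max 0 (f x) - max 0 (g x)\<bar>"
    using fin A by (simp add: measure_point_measure_ennreal sum_subtractf)
  also have "\<dots> \<le> (\<Sum>x\<in>A. \<bar>max 0 (f x) - max 0 (g x)\<bar>)" by (rule sum_abs)
  also have "\<dots> \<le> (\<Sum>x\<in>A. \<bar>f x - g x\<bar>)" by (intro sum_mono) (simp add: max_def)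
  also have "\<dots> \<le> (\<Sum>x\<in>X. \<bar>f x - g x\<bar>)" using fin A by (intro sum_mono2) auto
  finally show "\<bar>measure (point_measure X (\<lambda>x. ennreal (f x))) A
      - measure (point_measure X (\<lambda>x. ennreal (g x))) A\<bar> \<le> (\<Sum>x\<in>X. \<bar>f x - g x\<bar>)" .
qed (auto simp: sets_point_measure)

theorem theorem11:
  fixes J :: "real^'n^'n" and h :: "real^'n" and t \<epsilon> :: real
  assumes "transpose J = J"
    and "loewner_le 0 J" and "loewner_less J (mat 1)"
    and "0 < \<epsilon>" and "0 \<le> t"
    and "t \<ge> 1 / (1 - onorm ((*v) J)) *
           ((1 + 2 * onorm ((*v) J)) * real CARD('n) + 2 * (\<Sum>i\<in>UNIV. \<bar>h $ i\<bar>) + ln (1 / \<epsilon>))"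
  shows "(MAX x\<in>cube. tv_dist (glauber_kernel (ising_measure J h) t x) (ising_measure J h)) \<le> \<epsilon>"
proof -
  define \<theta> where "\<theta> = onorm ((*v) J)"
  define n where "n = real CARD('n)"
  define H where "H = (\<Sum>i\<in>UNIV. \<bar>h $ i\<bar>)"
  have psd: "0 \<le> y \<bullet> (J *v y)" for y using assms(2) by (simp add: loewner_le_def)
  have less: "y \<bullet> (J *v y) < y \<bullet> y" if "y \<noteq> 0" for y
    using assms(3) that by (simp add: loewner_less_def matrix_vector_mult_diff_rdistrib inner_diff_right)
  have \<theta>1: "\<theta> < 1" unfolding \<theta>_def by (rule onorm_psd_contraction[OF assms(1) psd less])
  have \<theta>0: "0 \<le> \<theta>" unfolding \<theta>_def by (intro onorm_pos_le matrix_vector_mul_bounded_linear)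
  have le\<theta>: "y \<bullet> (J *v y) \<le> \<theta> * (y \<bullet> y)" for y
  proof -
    have "y \<bullet> (J *v y) \<le> norm y * norm (J *v y)" by (rule norm_cauchy_schwarz)
    also have "\<dots> \<le> norm y * (\<theta> * norm y)"
      unfolding \<theta>_def by (intro mult_left_mono onorm matrix_vector_mul_bounded_linear) simp
    finally show ?thesis by (simp add: power2_norm_eq_inner[symmetric] power2_eq_square mult_ac)
  qed
  have n: "0 \<le> n" and H: "0 \<le> H" by (simp_all add: n_def H_def sum_nonneg)
  define w where "w = ising_weight J h"
  have w: "0 < w x" for x by (simp add: w_def ising_weight_pos)
  define S where "S = (\<Sum>y\<in>cube. w y)"
  have S: "0 < S" unfolding S_def using w by (intro sum_pos) auto
  define \<nu> where "\<nu> = point_measure cube (\<lambda>x. ennreal (w x / S))"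
  have ising: "ising_measure J h = \<nu>" by (simp add: ising_measure_eq \<nu>_def S_def w_def)
  have "tv_dist (glauber_kernel \<nu> t x) \<nu> \<le> \<epsilon>" if x: "x \<in> cube" for x
  proof -
    define P where "P y z = glauber_semigroup \<nu> t (indicator {y}) z" for y z
    define d where "d y = P y x - w y / S" for y
    \<comment> \<open>The variance sum dominates its single term at \<open>x\<close>, and the
      initial variance of the indicator is at most its second moment \<open>w y\<close>.\<close>
    have "w x * (d y)\<^sup>2 \<le> exp (- 2 * (1 - \<theta>) * t) * w y" if y: "y \<in> cube" for y
    proof -
      have mass: "(\<Sum>z\<in>cube. w z * indicator {y} z) = w y"
        using y by (simp add: indicator_def)
      have mean: "(\<Sum>z\<in>cube. w z * (indicator {y} z - w y / S)) = 0"
        using mass S unfolding right_diff_distrib sum_subtractf sum_distrib_right[symmetric] S_def[symmetric]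
        by simp
      have "w x * (d y)\<^sup>2 \<le> (\<Sum>z\<in>cube. w z * (P y z - w y / S)\<^sup>2)"
        unfolding d_def using x w
        by (intro member_le_sum[where f="\<lambda>z. w z * (P y z - w y / S)\<^sup>2"]) (auto simp: less_imp_le)
      also have "\<dots> \<le> exp (- 2 * (1 - \<theta>) * t) * (\<Sum>z\<in>cube. w z * (indicator {y} z - w y / S)\<^sup>2)"
        unfolding P_def glauber_semigroup_def
      proof (rule semigroup_variance_decay[OF w])
        show "glauber_generator \<nu> F z = (\<Sum>i\<in>UNIV. avg w i F z - F z)" if "z \<in> cube" for F z
          unfolding \<nu>_def by (rule glauber_generator_point_measure[OF w S that])
        show "\<exists>b. (1 - \<theta>) * (\<Sum>z\<in>cube. w z * (F z - b)\<^sup>2) \<le> dirichlet w F" for F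
          unfolding w_def by (rule ising_poincare[OF assms(1) psd le\<theta> \<theta>0 \<theta>1])
      qed (use \<theta>1 assms(5) mean in auto)
      also have "(\<Sum>z\<in>cube. w z * (indicator {y} z - w y / S)\<^sup>2) \<le> (\<Sum>z\<in>cube. w z * (indicator {y} z - 0)\<^sup>2)"
        by (rule mean_minimises) (use mean w in \<open>auto simp: less_imp_le\<close>)
      also have "(\<Sum>z\<in>cube. w z * (indicator {y} z - 0)\<^sup>2) = w y"
        unfolding mass[symmetric] by (rule sum.cong) (auto simp: indicator_def)
      finally show ?thesis by simp
    qed
    \<comment> \<open>Summing over the target \<open>y\<close> turns the weights \<open>w y\<close>
      into the total mass, so the loss is the ratio \<open>S / w x\<close>.\<close>
    then have "(\<Sum>y\<in>cube. w x * (d y)\<^sup>2) \<le> (\<Sum>y\<in>cube. exp (- 2 * (1 - \<theta>) * t) * w y)"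
      by (rule sum_mono)
    then have l2: "w x * (\<Sum>y\<in>cube. (d y)\<^sup>2) \<le> exp (- 2 * (1 - \<theta>) * t) * S"
      by (simp add: sum_distrib_left S_def)
    have rate: "(1 + 2 * \<theta>) * n + 2 * H + ln (1 / \<epsilon>) \<le> (1 - \<theta>) * t"
      using assms(6) \<theta>1 unfolding \<theta>_def[symmetric] n_def[symmetric] H_def[symmetric]
      by (simp add: pos_divide_le_eq mult.commute)
    have two: "(2 :: real) ^ CARD('n) \<le> exp n"
    proof -
      have "(2 :: real) ^ CARD('n) \<le> exp 1 ^ CARD('n)"
        using exp_ge_add_one_self[of 1] by (intro power_mono) auto
      then show ?thesis by (simp add: n_def exp_of_nat_mult[symmetric])
    qed
    \<comment> \<open>Cauchy-Schwarz over the target \<open>y\<close> costs the size of the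
      cube.\<close>
    have "w x * (\<Sum>y\<in>cube. \<bar>d y\<bar>)\<^sup>2 \<le> w x * (2 ^ CARD('n) * (\<Sum>y\<in>cube. (d y)\<^sup>2))"
    proof (rule mult_left_mono)
      have "(\<Sum>y\<in>cube. \<bar>d y\<bar>)\<^sup>2 \<le> (\<Sum>y\<in>(cube :: (real^'n) set). 1\<^sup>2) * (\<Sum>y\<in>cube. \<bar>d y\<bar>\<^sup>2)"
        using Cauchy_Schwarz_ineq_sum[of "\<lambda>_. 1" "\<lambda>y. \<bar>d y\<bar>" cube] by simp
      also have "\<dots> \<le> 2 ^ CARD('n) * (\<Sum>y\<in>cube. (d y)\<^sup>2)"
        using card_cube_le[where 'n='n] by (simp add: mult_right_mono sum_nonneg)
      finally show "(\<Sum>y\<in>cube. \<bar>d y\<bar>)\<^sup>2 \<le> 2 ^ CARD('n) * (\<Sum>y\<in>cube. (d y)\<^sup>2)" .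
    qed (use w in \<open>simp add: less_imp_le\<close>)
    also have "\<dots> = 2 ^ CARD('n) * (w x * (\<Sum>y\<in>cube. (d y)\<^sup>2))" by (simp only: mult_ac)
    also have "\<dots> \<le> 2 ^ CARD('n) * (exp (- 2 * (1 - \<theta>) * t) * S)"
      by (intro mult_left_mono l2) simp
    \<comment> \<open>One factor \<open>exp n\<close> pays for Cauchy-Schwarz, the other for the
      number of configurations in \<open>S\<close>.\<close>
    also have "\<dots> \<le> exp n * (exp (- 2 * (1 - \<theta>) * t) * (exp n * exp (\<theta> * n / 2 + 2 * H) * w x))"
    proof (intro mult_mono order.refl)
      have "S \<le> 2 ^ CARD('n) * exp (\<theta> * n / 2 + 2 * H) * w x"
        unfolding S_def w_def n_def H_def by (rule ising_mass_ratio_le[OF psd le\<theta> x])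
      also have "\<dots> \<le> exp n * exp (\<theta> * n / 2 + 2 * H) * w x"
        using w by (intro mult_right_mono two) (simp_all add: less_imp_le)
      finally show "S \<le> exp n * exp (\<theta> * n / 2 + 2 * H) * w x" .
    qed (use two S in simp_all)
    also have "\<dots> = w x * exp (2 * n + \<theta> * n / 2 + 2 * H - 2 * ((1 - \<theta>) * t))"
    proof -
      have "2 * n + \<theta> * n / 2 + 2 * H - 2 * ((1 - \<theta>) * t) = n + (- 2 * (1 - \<theta>) * t + (n + (\<theta> * n / 2 + 2 * H)))"
        by (simp add: algebra_simps)
      then show ?thesis by (simp only: exp_add mult_ac)
    qed
    also have "\<dots> \<le> w x * exp (2 * ln \<epsilon>)"
    proof -
      have "0 \<le> \<theta> * n" using \<theta>0 n by simp
      \<comment> \<open>Twice \<open>rate\<close> bounds \<open>2 * ((1 - \<theta>) * t)\<close>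
        below by \<open>2 n + 4 \<theta> n + 4 H - 2 ln \<epsilon>\<close>, which covers
        \<open>2 n + \<theta> n / 2 + 2 H - 2 ln \<epsilon>\<close>.\<close>
      then have "2 * n + \<theta> * n / 2 + 2 * H - 2 * ((1 - \<theta>) * t) \<le> 2 * ln \<epsilon>"
        using rate H assms(4) by (simp add: ln_div algebra_simps)
      then show ?thesis using w[of x] by simp
    qed
    also have "exp (2 * ln \<epsilon>) = \<epsilon>\<^sup>2"
      using assms(4) exp_of_nat_mult[of 2 "ln \<epsilon>"] by simp
    finally have "(\<Sum>y\<in>cube. \<bar>d y\<bar>)\<^sup>2 \<le> \<epsilon>\<^sup>2" using w[of x] by simp
    then have "(\<Sum>y\<in>cube. \<bar>d y\<bar>) \<le> \<epsilon>" by (rule power2_le_imp_le) (use assms(4) in simp)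
    moreover have "tv_dist (glauber_kernel \<nu> t x) \<nu> \<le> (\<Sum>y\<in>cube. \<bar>d y\<bar>)"
      unfolding glauber_kernel_def d_def P_def
      by (subst (2) \<nu>_def, rule tv_dist_point_measure_le) (use w S in \<open>auto simp: less_imp_le\<close>)
    ultimately show ?thesis by linarith
  qed
  then show ?thesis unfolding ising by (subst Max_le_iff) auto
qed

end
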